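(* Let $n$ be a positive integer, let $\mathbf{A}$ be an infinite $n$-generated subdirectly irreducible bi-Heyting algebra validating $LFC$, let $\mathfrak{X}=\mathbf{A}_*$ with greatest element $r$, and let $m$ be a minimal element of $\mathfrak{X}$ with $X=\{x:m<x\}\uplus min(\mathfrak{X})$ and such that every minimal $y\ne m$ has a unique immediate successor lying strictly above $m$. Write $\Downarrow x$ for the set of immediate predecessors of $x$, and $\uparrow m=\{x: m\le x\}$. Then: (i) if $x$ is an up limit, then $2\le|\Downarrow x|\le 2^n$; (ii) $\mathfrak{X}$ has no down limits; (iii) $\uparrow m$ is an infinite well-order; (iv) if $x$ is an immediate successor of $m$, then $|\Downarrow x|\le 2$; (v) if $m<x$, $x$ is not an immediate successor of $m$ and $x$ is not an up limit, then $x$ has exactly one immediate predecessor $z$ with $m<z$ and exactly one immediate predecessor $z$ with $m\not<z$.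
   Context: Bi-Heyting algebras are bounded distributive lattices with residuated $\to$ and $\leftarrow$. $\mathbf{A}_*$ is the bi-Esakia dual of $\mathbf{A}$: prime filters ordered by inclusion with the Priestley topology. For SI $\mathbf{A}$ validating $\mathsf{bi\text{-}LC}$ (bi-intuitionistic logic plus $(p\to q)\vee(q\to p)$), $\mathbf{A}_*$ is a bi-Esakia co-tree: it has a greatest element and principal upsets are chains. $LFC=\mathsf{bi\text{-}LC}+\beta(\mathfrak{F}_0)+\mathcal{J}(\mathfrak{F}_1)+\mathcal{J}(\mathfrak{F}_2)+\mathcal{J}(\mathfrak{F}_3)$. For a finite co-tree $\mathfrak{Y}$: - $\mathfrak{X}\not\models\beta(\mathfrak{Y})$ iff $\mathfrak{Y}$ order-embeds into $\mathfrak{X}$; - $\mathfrak{X}\not\models\mathcal{J}(\mathfrak{Y})$ iff there is a continuous surjective bi-p-morphism onto $\mathfrak{Y}$. The co-trees are: - $\mathfrak{F}_0$: $d<b<a$, $e<c<a$; - $\mathfrak{F}_1$: the chain $c<b<a$; - $\mathfrak{F}_2$: the chain $d<c<b<a$ plus $a'<a$, with $a'$ incomparable to $b,c,d$; - $\mathfrak{F}_3$: a top over three incomparable minimal points. A point $x$ with $m<x$ is an up limit if $x$ has no immediate predecessor in $\uparrow m$. A point $x\in\uparrow m\setminus\{r\}$ is a down limit if $x$ has no immediate successor. *)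

theory Defs
  imports "HOL-Analysis.Analysis"
begin

definition bi_heyting ::
  "('a::{distrib_lattice,bounded_lattice} \<Rightarrow> 'a \<Rightarrow> 'a) \<Rightarrow> ('a \<Rightarrow> 'a \<Rightarrow> 'a) \<Rightarrow> bool" where
  "bi_heyting imp coimp \<longleftrightarrow>
     (\<forall>a b c. c \<le> imp a b \<longleftrightarrow> inf c a \<le> b) \<and>
     (\<forall>a b c. coimp a b \<le> c \<longleftrightarrow> a \<le> sup b c)"

definition bh_congruence ::
  "('a::{distrib_lattice,bounded_lattice} \<Rightarrow> 'a \<Rightarrow> 'a) \<Rightarrow> ('a \<Rightarrow> 'a \<Rightarrow> 'a) \<Rightarrow> 'a rel \<Rightarrow> bool" where
  "bh_congruence imp coimp \<theta> \<longleftrightarrow> equiv UNIV \<theta> \<and>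
     (\<forall>a b c d. (a, b) \<in> \<theta> \<longrightarrow> (c, d) \<in> \<theta> \<longrightarrow>
        (inf a c, inf b d) \<in> \<theta> \<and> (sup a c, sup b d) \<in> \<theta> \<and>
        (imp a c, imp b d) \<in> \<theta> \<and> (coimp a c, coimp b d) \<in> \<theta>)"

definition bh_SI ::
  "('a::{distrib_lattice,bounded_lattice} \<Rightarrow> 'a \<Rightarrow> 'a) \<Rightarrow> ('a \<Rightarrow> 'a \<Rightarrow> 'a) \<Rightarrow> bool" where
  "bh_SI imp coimp \<longleftrightarrow>
     (\<exists>\<mu>. bh_congruence imp coimp \<mu> \<and> \<mu> \<noteq> Id \<and>
          (\<forall>\<theta>. bh_congruence imp coimp \<theta> \<and> \<theta> \<noteq> Id \<longrightarrow> \<mu> \<subseteq> \<theta>))"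

inductive_set bh_generated ::
  "('a::{distrib_lattice,bounded_lattice} \<Rightarrow> 'a \<Rightarrow> 'a) \<Rightarrow> ('a \<Rightarrow> 'a \<Rightarrow> 'a) \<Rightarrow> 'a set \<Rightarrow> 'a set"
  for imp coimp G where
  gen: "a \<in> G \<Longrightarrow> a \<in> bh_generated imp coimp G"
| bot: "bot \<in> bh_generated imp coimp G"
| top: "top \<in> bh_generated imp coimp G"
| inf: "a \<in> bh_generated imp coimp G \<Longrightarrow> b \<in> bh_generated imp coimp G \<Longrightarrow> inf a b \<in> bh_generated imp coimp G"
| sup: "a \<in> bh_generated imp coimp G \<Longrightarrow> b \<in> bh_generated imp coimp G \<Longrightarrow> sup a b \<in> bh_generated imp coimp G"
| imp: "a \<in> bh_generated imp coimp G \<Longrightarrow> b \<in> bh_generated imp coimp G \<Longrightarrow> imp a b \<in> bh_generated imp coimp G"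
| coimp: "a \<in> bh_generated imp coimp G \<Longrightarrow> b \<in> bh_generated imp coimp G \<Longrightarrow> coimp a b \<in> bh_generated imp coimp G"

definition n_generated ::
  "nat \<Rightarrow> ('a::{distrib_lattice,bounded_lattice} \<Rightarrow> 'a \<Rightarrow> 'a) \<Rightarrow> ('a \<Rightarrow> 'a \<Rightarrow> 'a) \<Rightarrow> bool" where
  "n_generated n imp coimp \<longleftrightarrow>
     (\<exists>G. finite G \<and> card G \<le> n \<and> bh_generated imp coimp G = UNIV)"

definition prime_filter :: "'a::{distrib_lattice,bounded_lattice} set \<Rightarrow> bool" where
  "prime_filter P \<longleftrightarrow> top \<in> P \<and> bot \<notin> P \<and>
     (\<forall>a b. a \<in> P \<longrightarrow> a \<le> b \<longrightarrow> b \<in> P) \<and>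
     (\<forall>a b. a \<in> P \<longrightarrow> b \<in> P \<longrightarrow> inf a b \<in> P) \<and>
     (\<forall>a b. sup a b \<in> P \<longrightarrow> a \<in> P \<or> b \<in> P)"

text \<open>Points of A_*: prime filters, ordered by inclusion.\<close>
definition dual_pts :: "'a::{distrib_lattice,bounded_lattice} set set" where
  "dual_pts = {P. prime_filter P}"

definition stone_map :: "'a::{distrib_lattice,bounded_lattice} \<Rightarrow> 'a set set" where
  "stone_map a = {P \<in> dual_pts. a \<in> P}"

definition priestley_top :: "'a::{distrib_lattice,bounded_lattice} set topology" where
  "priestley_top = topology_generated_by
     (range stone_map \<union> (\<lambda>a. dual_pts - stone_map a) ` UNIV)"

definition order_embeds ::
  "'b set \<Rightarrow> ('b \<Rightarrow> 'b \<Rightarrow> bool) \<Rightarrow> 'c set \<Rightarrow> ('c \<Rightarrow> 'c \<Rightarrow> bool) \<Rightarrow> bool" where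
  "order_embeds Y leY X leX \<longleftrightarrow>
     (\<exists>f. f ` Y \<subseteq> X \<and> inj_on f Y \<and> (\<forall>y\<in>Y. \<forall>y'\<in>Y. leX (f y) (f y') \<longleftrightarrow> leY y y'))"

definition bi_p_morphism ::
  "('c \<Rightarrow> 'b) \<Rightarrow> 'c set \<Rightarrow> ('c \<Rightarrow> 'c \<Rightarrow> bool) \<Rightarrow> 'b set \<Rightarrow> ('b \<Rightarrow> 'b \<Rightarrow> bool) \<Rightarrow> bool" where
  "bi_p_morphism f X leX Y leY \<longleftrightarrow>
     f ` X \<subseteq> Y \<and>
     (\<forall>x\<in>X. \<forall>x'\<in>X. leX x x' \<longrightarrow> leY (f x) (f x')) \<and>
     (\<forall>x\<in>X. \<forall>y\<in>Y. leY (f x) y \<longrightarrow> (\<exists>x'\<in>X. leX x x' \<and> f x' = y)) \<and>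
     (\<forall>x\<in>X. \<forall>y\<in>Y. leY y (f x) \<longrightarrow> (\<exists>x'\<in>X. leX x' x \<and> f x' = y))"

definition maps_onto ::
  "('a::{distrib_lattice,bounded_lattice} itself) \<Rightarrow> nat set \<Rightarrow> (nat \<Rightarrow> nat \<Rightarrow> bool) \<Rightarrow> bool" where
  "maps_onto TYPE('a) Y leY \<longleftrightarrow>
     (\<exists>f :: 'a set \<Rightarrow> nat.
        continuous_map (priestley_top :: 'a set topology) (discrete_topology Y) f \<and>
        f ` (dual_pts :: 'a set set) = Y \<and>
        bi_p_morphism f dual_pts (\<subseteq>) Y leY)"

text \<open>F0: a=0, b=1, c=2, d=3, e=4 with d<b<a, e<c<a.\<close>
definition F0 :: "nat set" where "F0 = {0,1,2,3,4}"
definition leF0 :: "nat \<Rightarrow> nat \<Rightarrow> bool" where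
  "leF0 x y \<longleftrightarrow> x = y \<or> (x, y) \<in> {(1,0),(3,1),(3,0),(2,0),(4,2),(4,0)}"

text \<open>F1: the chain c<b<a with a=0, b=1, c=2.\<close>
definition F1 :: "nat set" where "F1 = {0,1,2}"
definition leF1 :: "nat \<Rightarrow> nat \<Rightarrow> bool" where "leF1 x y \<longleftrightarrow> y \<le> x"

text \<open>F2: chain d<c<b<a (a=0,b=1,c=2,d=3) plus a'=4 with a'<a only.\<close>
definition F2 :: "nat set" where "F2 = {0,1,2,3,4}"
definition leF2 :: "nat \<Rightarrow> nat \<Rightarrow> bool" where
  "leF2 x y \<longleftrightarrow> x = y \<or> (x \<le> 3 \<and> y \<le> x) \<or> (x = 4 \<and> y = 0)"

definition F3 :: "nat set" where "F3 = {0,1,2,3}"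
definition leF3 :: "nat \<Rightarrow> nat \<Rightarrow> bool" where "leF3 x y \<longleftrightarrow> x = y \<or> y = 0"

definition validates_biLC ::
  "('a::{distrib_lattice,bounded_lattice} \<Rightarrow> 'a \<Rightarrow> 'a) \<Rightarrow> bool" where
  "validates_biLC imp \<longleftrightarrow> (\<forall>a b. sup (imp a b) (imp b a) = top)"

text \<open>A validates beta(F0) iff F0 does not order-embed into A_*; A validates J(F) iff
  there is no continuous surjective bi-p-morphism from A_* onto F.\<close>
definition validates_LFC ::
  "('a::{distrib_lattice,bounded_lattice} \<Rightarrow> 'a \<Rightarrow> 'a) \<Rightarrow> ('a \<Rightarrow> 'a \<Rightarrow> 'a) \<Rightarrow> bool" where
  "validates_LFC imp coimp \<longleftrightarrow>
     validates_biLC imp \<and>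
     \<not> order_embeds F0 leF0 (dual_pts :: 'a set set) (\<subseteq>) \<and>
     \<not> maps_onto TYPE('a) F1 leF1 \<and>
     \<not> maps_onto TYPE('a) F2 leF2 \<and>
     \<not> maps_onto TYPE('a) F3 leF3"

definition imm_pred :: "'a::{distrib_lattice,bounded_lattice} set \<Rightarrow> 'a set \<Rightarrow> bool" where
  "imm_pred z x \<longleftrightarrow> z \<in> dual_pts \<and> x \<in> dual_pts \<and> z \<subset> x \<and>
     \<not> (\<exists>w\<in>dual_pts. z \<subset> w \<and> w \<subset> x)"

definition imm_preds :: "'a::{distrib_lattice,bounded_lattice} set \<Rightarrow> 'a set set" where
  "imm_preds x = {z. imm_pred z x}"

definition minimals :: "'a::{distrib_lattice,bounded_lattice} set set" where
  "minimals = {x \<in> dual_pts. \<not> (\<exists>y\<in>dual_pts. y \<subset> x)}"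

definition up_set :: "'a::{distrib_lattice,bounded_lattice} set \<Rightarrow> 'a set set" where
  "up_set m = {x \<in> dual_pts. m \<subseteq> x}"

definition up_limit :: "'a::{distrib_lattice,bounded_lattice} set \<Rightarrow> 'a set \<Rightarrow> bool" where
  "up_limit m x \<longleftrightarrow> x \<in> dual_pts \<and> m \<subset> x \<and> \<not> (\<exists>z\<in>up_set m. imm_pred z x)"

definition down_limit :: "'a::{distrib_lattice,bounded_lattice} set \<Rightarrow> 'a set \<Rightarrow> 'a set \<Rightarrow> bool" where
  "down_limit m r x \<longleftrightarrow> x \<in> up_set m - {r} \<and> \<not> (\<exists>y. imm_pred x y)"

end

theory Submission
  imports Defs
begin

text \<open>
  The space is a comb: a chain \<open>up_set m\<close>, whose points above \<open>m\<close> form the spine, with minimal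
  points hanging from it. The forbidden images \<open>F1\<close>, \<open>F2\<close>, \<open>F3\<close> force exactly one minimal point to
  hang from each spine point that has an immediate predecessor on the spine. Colour each point by
  the generators it contains. A colour-preserving bisimulation for \<open>\<subseteq>\<close> and \<open>\<supseteq>\<close> is trivial, because
  the elements it does not distinguish form a subalgebra containing the generators; so no segment
  of the spine can be collapsed, and equally coloured points hanging from the same spine point
  coincide, which bounds their number. By compactness, near a limit point of the spine the colour of
  the spine is constant and every colour of a hanging point recurs at the limit. At a down limit a
  whole segment could thus be collapsed: there are no down limits, and the spine is well ordered.
  At an up limit with only one hanging point, all nearby hanging points would have the same colour,
  and again a segment could be collapsed.
\<close>

section \<open>Prime filters of distributive lattices\<close>

definition lattice_filter :: "'a::semilattice_inf set \<Rightarrow> bool" where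
  "lattice_filter F \<longleftrightarrow>
     F \<noteq> {} \<and> (\<forall>a\<in>F. \<forall>b. a \<le> b \<longrightarrow> b \<in> F) \<and> (\<forall>a\<in>F. \<forall>b\<in>F. inf a b \<in> F)"

definition lattice_ideal :: "'a::semilattice_sup set \<Rightarrow> bool" where
  "lattice_ideal I \<longleftrightarrow>
     I \<noteq> {} \<and> (\<forall>a\<in>I. \<forall>b. b \<le> a \<longrightarrow> b \<in> I) \<and> (\<forall>a\<in>I. \<forall>b\<in>I. sup a b \<in> I)"

definition filter_adjoin :: "'a::semilattice_inf set \<Rightarrow> 'a \<Rightarrow> 'a set" where
  "filter_adjoin F a = {c. \<exists>d\<in>F. inf d a \<le> c}"

definition ideal_adjoin :: "'a::semilattice_sup set \<Rightarrow> 'a \<Rightarrow> 'a set" where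
  "ideal_adjoin I b = {c. \<exists>d\<in>I. c \<le> sup d b}"

lemma lattice_filter_atLeast: "lattice_filter {a..}"
  unfolding lattice_filter_def by (auto intro: order_trans)

lemma lattice_ideal_atMost: "lattice_ideal {..a}"
  unfolding lattice_ideal_def by (auto intro: order_trans)

lemma subset_filter_adjoin: "F \<subseteq> filter_adjoin F a"
  unfolding filter_adjoin_def by (auto intro: inf_le1)

lemma mem_filter_adjoin: "lattice_filter F \<Longrightarrow> a \<in> filter_adjoin F a"
  unfolding filter_adjoin_def lattice_filter_def by auto

lemma subset_ideal_adjoin: "I \<subseteq> ideal_adjoin I b"
  unfolding ideal_adjoin_def by (auto intro: sup_ge1)

lemma mem_ideal_adjoin: "lattice_ideal I \<Longrightarrow> b \<in> ideal_adjoin I b"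
  unfolding ideal_adjoin_def lattice_ideal_def by auto

lemma lattice_filter_adjoin:
  assumes "lattice_filter F"
  shows "lattice_filter (filter_adjoin F a)"
proof -
  have "inf b c \<in> filter_adjoin F a" if bc: "b \<in> filter_adjoin F a" "c \<in> filter_adjoin F a" for b c
  proof -
    obtain d e where "d \<in> F" "inf d a \<le> b" "e \<in> F" "inf e a \<le> c"
      using bc unfolding filter_adjoin_def by blast
    moreover from this have "inf (inf d e) a \<le> inf b c"
      by (meson inf.boundedI inf_le1 inf_le2 inf_mono order.trans order_refl)
    ultimately show ?thesis
      using assms unfolding lattice_filter_def filter_adjoin_def by blast
  qed
  moreover have "filter_adjoin F a \<noteq> {}"
    using mem_filter_adjoin[OF assms] by blast
  ultimately show ?thesis
    unfolding lattice_filter_def filter_adjoin_def by (auto intro: order_trans)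
qed

lemma lattice_ideal_adjoin:
  assumes "lattice_ideal I"
  shows "lattice_ideal (ideal_adjoin I b)"
proof -
  have "sup a c \<in> ideal_adjoin I b" if ac: "a \<in> ideal_adjoin I b" "c \<in> ideal_adjoin I b" for a c
  proof -
    obtain d e where "d \<in> I" "a \<le> sup d b" "e \<in> I" "c \<le> sup e b"
      using ac unfolding ideal_adjoin_def by blast
    moreover from this have "sup a c \<le> sup (sup d e) b"
      by (meson sup.boundedI sup_ge1 sup_ge2 sup_mono order.trans order_refl)
    ultimately show ?thesis
      using assms unfolding lattice_ideal_def ideal_adjoin_def by blast
  qed
  moreover have "ideal_adjoin I b \<noteq> {}"
    using mem_ideal_adjoin[OF assms] by blast
  ultimately show ?thesis
    unfolding lattice_ideal_def ideal_adjoin_def by (auto intro: order_trans)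
qed

lemma lattice_filter_Union_chain:
  assumes "\<C> \<noteq> {}" "subset.chain (Collect lattice_filter) \<C>"
  shows "lattice_filter (\<Union>\<C>)"
proof -
  have filter: "lattice_filter H" if "H \<in> \<C>" for H
    using that assms(2) unfolding subset_chain_def by blast
  have "inf a b \<in> \<Union>\<C>" if "a \<in> \<Union>\<C>" "b \<in> \<Union>\<C>" for a b
  proof -
    obtain H where "H \<in> \<C>" "{a, b} \<subseteq> H"
      by (rule finite_subset_Union_chain[OF _ _ assms, of "{a, b}"])
        (use \<open>a \<in> \<Union>\<C>\<close> \<open>b \<in> \<Union>\<C>\<close> in auto)
    then show ?thesis using filter unfolding lattice_filter_def by blast
  qed
  moreover have "b \<in> \<Union>\<C>" if "a \<in> \<Union>\<C>" "a \<le> b" for a b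
    using that filter unfolding lattice_filter_def by blast
  moreover have "\<Union>\<C> \<noteq> {}"
    using assms(1) filter unfolding lattice_filter_def by (auto simp: ex_in_conv[symmetric])
  ultimately show ?thesis unfolding lattice_filter_def by blast
qed

lemma maximal_disjoint_filter_exists:
  assumes "lattice_filter F" "F \<inter> I = {}"
  obtains M where "lattice_filter M" "F \<subseteq> M" "M \<inter> I = {}"
    and "\<And>H. lattice_filter H \<Longrightarrow> M \<subseteq> H \<Longrightarrow> H \<inter> I = {} \<Longrightarrow> H = M"
proof -
  define \<A> where "\<A> = {H. lattice_filter H \<and> F \<subseteq> H \<and> H \<inter> I = {}}"
  have "\<exists>M\<in>\<A>. \<forall>H\<in>\<A>. M \<subseteq> H \<longrightarrow> H = M"
  proof (rule subset_Zorn_nonempty)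
    show "\<A> \<noteq> {}" using assms unfolding \<A>_def by blast
    fix \<C> assume \<C>: "\<C> \<noteq> {}" "subset.chain \<A> \<C>"
    then have "lattice_filter (\<Union>\<C>)"
      unfolding \<A>_def by (intro lattice_filter_Union_chain) (auto simp: subset_chain_def)
    moreover have "F \<subseteq> H" "H \<inter> I = {}" if "H \<in> \<C>" for H
      using \<C>(2) that unfolding \<A>_def subset_chain_def by auto
    then have "F \<subseteq> \<Union>\<C>" "\<Union>\<C> \<inter> I = {}" using \<C>(1) by blast+
    ultimately show "\<Union>\<C> \<in> \<A>" unfolding \<A>_def by simp
  qed
  then obtain M where M: "M \<in> \<A>" "\<And>H. H \<in> \<A> \<Longrightarrow> M \<subseteq> H \<Longrightarrow> H = M" by metis
  show thesis
  proof (rule that)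
    show "lattice_filter M" "F \<subseteq> M" "M \<inter> I = {}"
      using M(1) unfolding \<A>_def by simp_all
    show "H = M" if "lattice_filter H" "M \<subseteq> H" "H \<inter> I = {}" for H
      using M(1) that by (intro M(2)) (auto simp: \<A>_def)
  qed
qed

lemma lattice_filter_iff_top:
  fixes F :: "'a::bounded_lattice set"
  shows "lattice_filter F \<longleftrightarrow>
     top \<in> F \<and> (\<forall>a b. a \<in> F \<longrightarrow> a \<le> b \<longrightarrow> b \<in> F) \<and> (\<forall>a b. a \<in> F \<longrightarrow> b \<in> F \<longrightarrow> inf a b \<in> F)"
  unfolding lattice_filter_def by (auto intro: top_greatest)

lemma prime_filter_iff:
  "prime_filter P \<longleftrightarrow>
     lattice_filter P \<and> bot \<notin> P \<and> (\<forall>a b. sup a b \<in> P \<longrightarrow> a \<in> P \<or> b \<in> P)"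
  by (auto simp: prime_filter_def lattice_filter_iff_top)

lemma prime_filter_if_maximal_disjoint:
  fixes M I :: "'a::{distrib_lattice,bounded_lattice} set"
  assumes M: "lattice_filter M" and I: "lattice_ideal I" and disj: "M \<inter> I = {}"
    and maximal: "\<And>H. lattice_filter H \<Longrightarrow> M \<subseteq> H \<Longrightarrow> H \<inter> I = {} \<Longrightarrow> H = M"
  shows "prime_filter M"
proof -
  have meets: "\<exists>d\<in>M. \<exists>i\<in>I. inf d a \<le> i" if "a \<notin> M" for a
  proof -
    have "filter_adjoin M a \<noteq> M" using mem_filter_adjoin[OF M] that by blast
    then have "filter_adjoin M a \<inter> I \<noteq> {}"
      using maximal lattice_filter_adjoin[OF M] subset_filter_adjoin by blast
    then show ?thesis unfolding filter_adjoin_def by blast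
  qed
  have "a \<in> M \<or> b \<in> M" if "sup a b \<in> M" for a b
  proof (rule ccontr)
    assume "\<not> ?thesis"
    then obtain d i e j where below: "d \<in> M" "i \<in> I" "inf d a \<le> i" "e \<in> M" "j \<in> I" "inf e b \<le> j"
      using meets by meson
    have "inf (inf d e) (sup a b) = sup (inf (inf d e) a) (inf (inf d e) b)"
      by (rule inf_sup_distrib1)
    also have "\<dots> \<le> sup i j"
      by (rule sup_mono; meson below inf_le1 inf_le2 inf_mono order.trans order_refl)
    finally have "sup i j \<in> M"
      using M below that unfolding lattice_filter_def by blast
    then show False using I below disj unfolding lattice_ideal_def by blast
  qed
  moreover have "bot \<notin> M"
    using I disj bot_least unfolding lattice_ideal_def by blast
  ultimately show ?thesis using M by (simp add: prime_filter_iff)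
qed

theorem prime_filter_separation:
  fixes F I :: "'a::{distrib_lattice,bounded_lattice} set"
  assumes "lattice_filter F" "lattice_ideal I" "F \<inter> I = {}"
  obtains P where "P \<in> dual_pts" "F \<subseteq> P" "P \<inter> I = {}"
proof -
  obtain M where M: "lattice_filter M" "F \<subseteq> M" "M \<inter> I = {}"
    and maximal: "\<And>H. lattice_filter H \<Longrightarrow> M \<subseteq> H \<Longrightarrow> H \<inter> I = {} \<Longrightarrow> H = M"
    using maximal_disjoint_filter_exists[OF assms(1,3)] by blast
  have "prime_filter M"
    using prime_filter_if_maximal_disjoint[OF M(1) assms(2) M(3) maximal] .
  then show thesis using that[of M] M unfolding dual_pts_def by blast
qed

lemma dual_ptsD:
  assumes "P \<in> dual_pts"
  shows dual_pts_top: "top \<in> P" and dual_pts_bot: "bot \<notin> P"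
    and dual_pts_upward: "a \<in> P \<Longrightarrow> a \<le> b \<Longrightarrow> b \<in> P"
    and dual_pts_inf_iff: "inf a b \<in> P \<longleftrightarrow> a \<in> P \<and> b \<in> P"
    and dual_pts_sup_iff: "sup a b \<in> P \<longleftrightarrow> a \<in> P \<or> b \<in> P"
proof -
  have P: "prime_filter P" using assms unfolding dual_pts_def by simp
  then show "top \<in> P" "bot \<notin> P" and up: "\<And>a b. a \<in> P \<Longrightarrow> a \<le> b \<Longrightarrow> b \<in> P"
    unfolding prime_filter_def by blast+
  show "inf a b \<in> P \<longleftrightarrow> a \<in> P \<and> b \<in> P"
    using P up inf_le1 inf_le2 unfolding prime_filter_def by metis
  show "sup a b \<in> P \<longleftrightarrow> a \<in> P \<or> b \<in> P"
    using P up sup_ge1 sup_ge2 unfolding prime_filter_def by metis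
qed

lemma lattice_filter_dual_pts: "P \<in> dual_pts \<Longrightarrow> lattice_filter P"
  unfolding dual_pts_def prime_filter_iff by blast

lemma lattice_ideal_Compl_dual_pts:
  assumes "P \<in> dual_pts"
  shows "lattice_ideal (- P)"
  using dual_ptsD[OF assms] unfolding lattice_ideal_def by blast

lemma dual_pts_Inter_chain:
  assumes "\<C> \<noteq> {}" "subset.chain dual_pts \<C>"
  shows "\<Inter>\<C> \<in> dual_pts"
proof -
  have pts: "\<C> \<subseteq> dual_pts" using assms(2) unfolding subset_chain_def by blast
  have "a \<in> \<Inter>\<C> \<or> b \<in> \<Inter>\<C>" if "sup a b \<in> \<Inter>\<C>" for a b
  proof (rule ccontr)
    assume "\<not> ?thesis"
    then obtain S T where "S \<in> \<C>" "a \<notin> S" "T \<in> \<C>" "b \<notin> T" by blast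
    then obtain R where "R \<in> \<C>" "a \<notin> R" "b \<notin> R"
      using assms(2) unfolding subset_chain_def by blast
    then show False using that pts dual_pts_sup_iff by blast
  qed
  moreover have "top \<in> \<Inter>\<C>" "bot \<notin> \<Inter>\<C>" "\<And>a b. a \<in> \<Inter>\<C> \<Longrightarrow> a \<le> b \<Longrightarrow> b \<in> \<Inter>\<C>"
    "\<And>a b. a \<in> \<Inter>\<C> \<Longrightarrow> b \<in> \<Inter>\<C> \<Longrightarrow> inf a b \<in> \<Inter>\<C>"
    using assms(1) pts
    by (auto dest: dual_pts_top dual_pts_bot dual_pts_upward dual_pts_inf_iff[THEN iffD2])
  ultimately show ?thesis
    unfolding dual_pts_def prime_filter_def by blast
qed

lemma dual_pts_Union_chain:
  assumes "\<C> \<noteq> {}" "subset.chain dual_pts \<C>"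
  shows "\<Union>\<C> \<in> dual_pts"
proof -
  have pts: "\<C> \<subseteq> dual_pts" using assms(2) unfolding subset_chain_def by blast
  have "lattice_filter (\<Union>\<C>)"
    using assms lattice_filter_dual_pts
    by (intro lattice_filter_Union_chain) (auto simp: subset_chain_def)
  moreover have "bot \<notin> \<Union>\<C>" "\<And>a b. sup a b \<in> \<Union>\<C> \<Longrightarrow> a \<in> \<Union>\<C> \<or> b \<in> \<Union>\<C>"
    using pts dual_pts_bot dual_pts_sup_iff by blast+
  ultimately show ?thesis
    unfolding dual_pts_def prime_filter_iff by blast
qed

lemma inj_stone_map: "inj stone_map"
proof (rule injI)
  have le: "a \<le> b" if "stone_map a = stone_map b" for a b :: 'a
  proof (rule ccontr)
    assume "\<not> a \<le> b"
    then have "{a..} \<inter> {..b} = {}" by (auto intro: order_trans)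
    then obtain P where "P \<in> dual_pts" "{a..} \<subseteq> P" "P \<inter> {..b} = {}"
      by (rule prime_filter_separation[OF lattice_filter_atLeast lattice_ideal_atMost])
    then show False using that unfolding stone_map_def by auto
  qed
  show "a = b" if "stone_map a = stone_map b" for a b :: 'a
    using le[OF that] le[OF that[symmetric]] by simp
qed

lemma infinite_dual_pts:
  assumes "infinite (UNIV :: 'a::{distrib_lattice,bounded_lattice} set)"
  shows "infinite (dual_pts :: 'a set set)"
proof
  assume "finite (dual_pts :: 'a set set)"
  moreover have "range stone_map \<subseteq> Pow (dual_pts :: 'a set set)"
    unfolding stone_map_def by blast
  ultimately have "finite (range (stone_map :: 'a \<Rightarrow> _))"
    using finite_subset by blast
  then show False
    using assms inj_stone_map finite_imageD by blast
qed

section \<open>The Priestley topology\<close>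

lemma topology_generated_by_eq_subbase:
  "topology (arbitrary union_of (finite intersection_of (\<lambda>U. U \<in> \<B>) relative_to \<Union>\<B>)) =
     topology_generated_by \<B>" (is "?X = ?Y")
proof (unfold topology_eq, intro allI iffI)
  show "openin ?Y U" if "openin ?X U" for U
    using that by (rule minimal_topology_subbase[rotated 2])
      (auto intro: topology_generated_by_Basis simp flip: topology_generated_by_topspace)
  have "openin ?X B" if "B \<in> \<B>" for B
    using that unfolding openin_subbase
    by (metis Union_upper arbitrary_union_of_inc finite_intersection_of_inc relative_to_subset_inc)
  then show "openin ?X U" if "openin ?Y U" for U
    using generate_topology_on_coarsest[OF istopology_openin] that
    by (metis openin_topology_generated_by)
qed

lemma compact_space_topology_generated_byI:
  assumes "\<And>\<C>. \<C> \<subseteq> \<B> \<Longrightarrow> \<Union>\<B> \<subseteq> \<Union>\<C> \<Longrightarrow> \<exists>\<D>. finite \<D> \<and> \<D> \<subseteq> \<C> \<and> \<Union>\<B> \<subseteq> \<Union>\<D>"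
  shows "compact_space (topology_generated_by \<B>)"
  using Alexander_subbase_alt[OF subset_refl assms topology_generated_by_eq_subbase] .

lemma topspace_priestley_top: "topspace priestley_top = dual_pts"
  unfolding priestley_top_def stone_map_def by (auto simp: dual_pts_top)

lemma openin_stone_map: "openin priestley_top (stone_map a)"
  unfolding priestley_top_def by (auto intro: topology_generated_by_Basis)

lemma openin_Diff_stone_map: "openin priestley_top (dual_pts - stone_map a)"
  unfolding priestley_top_def by (auto intro: topology_generated_by_Basis)

definition generated_filter :: "'a::{distrib_lattice,bounded_lattice} set \<Rightarrow> 'a set" where
  "generated_filter B = {c. \<exists>H. finite H \<and> H \<subseteq> B \<and> (\<forall>P\<in>dual_pts. H \<subseteq> P \<longrightarrow> c \<in> P)}"

definition generated_ideal :: "'a::{distrib_lattice,bounded_lattice} set \<Rightarrow> 'a set" where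
  "generated_ideal A = {c. \<exists>K. finite K \<and> K \<subseteq> A \<and> (\<forall>P\<in>dual_pts. c \<in> P \<longrightarrow> K \<inter> P \<noteq> {})}"

lemma lattice_filter_generated_filter: "lattice_filter (generated_filter B)"
  unfolding lattice_filter_iff_top
proof (intro conjI allI impI)
  show "top \<in> generated_filter B"
    unfolding generated_filter_def by (auto simp: dual_pts_top)
  show "d \<in> generated_filter B" if "c \<in> generated_filter B" "c \<le> d" for c d
    using that unfolding generated_filter_def mem_Collect_eq by (meson dual_pts_upward)
  show "inf c d \<in> generated_filter B"
    if c: "c \<in> generated_filter B" and d: "d \<in> generated_filter B" for c d
  proof -
    obtain H where "finite H" "H \<subseteq> B" "\<forall>P\<in>dual_pts. H \<subseteq> P \<longrightarrow> c \<in> P"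
      using c unfolding generated_filter_def by auto
    moreover obtain K where "finite K" "K \<subseteq> B" "\<forall>P\<in>dual_pts. K \<subseteq> P \<longrightarrow> d \<in> P"
      using d unfolding generated_filter_def by auto
    ultimately show ?thesis
      unfolding generated_filter_def by (auto simp: dual_pts_inf_iff intro!: exI[of _ "H \<union> K"])
  qed
qed

lemma lattice_ideal_generated_ideal: "lattice_ideal (generated_ideal A)"
  unfolding lattice_ideal_def
proof (intro conjI ballI allI impI)
  have "bot \<in> generated_ideal A"
    unfolding generated_ideal_def by (auto simp: dual_pts_bot)
  then show "generated_ideal A \<noteq> {}" by blast
  show "d \<in> generated_ideal A" if "c \<in> generated_ideal A" "d \<le> c" for c d
    using that unfolding generated_ideal_def mem_Collect_eq by (meson dual_pts_upward)
  show "sup c d \<in> generated_ideal A"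
    if c: "c \<in> generated_ideal A" and d: "d \<in> generated_ideal A" for c d
  proof -
    obtain H where "finite H" "H \<subseteq> A" "\<forall>P\<in>dual_pts. c \<in> P \<longrightarrow> H \<inter> P \<noteq> {}"
      using c unfolding generated_ideal_def by auto
    moreover obtain K where "finite K" "K \<subseteq> A" "\<forall>P\<in>dual_pts. d \<in> P \<longrightarrow> K \<inter> P \<noteq> {}"
      using d unfolding generated_ideal_def by auto
    ultimately show ?thesis
      unfolding generated_ideal_def by (auto simp: dual_pts_sup_iff intro!: exI[of _ "H \<union> K"])
  qed
qed

lemma dual_pts_finite_separation:
  fixes A B :: "'a::{distrib_lattice,bounded_lattice} set"
  assumes meets: "\<And>P. P \<in> dual_pts \<Longrightarrow> B \<subseteq> P \<Longrightarrow> A \<inter> P \<noteq> {}"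
  obtains H K where "finite H" "H \<subseteq> B" "finite K" "K \<subseteq> A"
    and "\<And>P. P \<in> dual_pts \<Longrightarrow> H \<subseteq> P \<Longrightarrow> K \<inter> P \<noteq> {}"
proof -
  have "generated_filter B \<inter> generated_ideal A \<noteq> {}"
  proof
    assume "generated_filter B \<inter> generated_ideal A = {}"
    then obtain P where P: "P \<in> dual_pts" "generated_filter B \<subseteq> P" "P \<inter> generated_ideal A = {}"
      by (rule prime_filter_separation[OF lattice_filter_generated_filter
            lattice_ideal_generated_ideal])
    have "B \<subseteq> generated_filter B"
      unfolding generated_filter_def by (auto intro!: exI[of _ "{_}"])
    moreover have "A \<subseteq> generated_ideal A"
      unfolding generated_ideal_def by (auto intro!: exI[of _ "{_}"])
    ultimately show False using meets[OF P(1)] P(2,3) by blast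
  qed
  then obtain c where c: "c \<in> generated_filter B" "c \<in> generated_ideal A" by blast
  obtain H where H: "finite H" "H \<subseteq> B" "\<forall>P\<in>dual_pts. H \<subseteq> P \<longrightarrow> c \<in> P"
    using c(1) unfolding generated_filter_def by auto
  obtain K where K: "finite K" "K \<subseteq> A" "\<forall>P\<in>dual_pts. c \<in> P \<longrightarrow> K \<inter> P \<noteq> {}"
    using c(2) unfolding generated_ideal_def by auto
  show thesis using that[of H K] H K by blast
qed

theorem compact_space_priestley_top:
  "compact_space (priestley_top :: 'a::{distrib_lattice,bounded_lattice} set topology)"
  unfolding priestley_top_def
proof (rule compact_space_topology_generated_byI)
  fix \<C> :: "'a set set set"
  let ?compl = "\<lambda>a :: 'a. dual_pts - stone_map a"
  let ?\<B> = "range stone_map \<union> range ?compl"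
  assume \<C>: "\<C> \<subseteq> ?\<B>" and cover: "\<Union>?\<B> \<subseteq> \<Union>\<C>"
  have \<B>: "\<Union>?\<B> = dual_pts"
    using topspace_priestley_top unfolding priestley_top_def topology_generated_by_topspace .
  define A where "A = {a. stone_map a \<in> \<C>}"
  define B where "B = {b. ?compl b \<in> \<C>}"
  have "A \<inter> P \<noteq> {}" if P: "P \<in> dual_pts" "B \<subseteq> P" for P
  proof -
    obtain U where U: "U \<in> \<C>" "P \<in> U" using P(1) cover unfolding \<B> by blast
    then consider a where "U = stone_map a" | b where "U = ?compl b" using \<C> by blast
    then show ?thesis
      using U P unfolding A_def B_def stone_map_def by cases auto
  qed
  then obtain H K where HK: "finite H" "H \<subseteq> B" "finite K" "K \<subseteq> A"
    and sep: "\<And>P. P \<in> dual_pts \<Longrightarrow> H \<subseteq> P \<Longrightarrow> K \<inter> P \<noteq> {}"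
    using dual_pts_finite_separation[of B A] by metis
  have "dual_pts \<subseteq> \<Union>(stone_map ` K \<union> ?compl ` H)"
  proof
    fix P :: "'a set" assume "P \<in> dual_pts"
    then show "P \<in> \<Union>(stone_map ` K \<union> ?compl ` H)"
      using sep[of P] unfolding stone_map_def by auto
  qed
  then show "\<exists>\<D>. finite \<D> \<and> \<D> \<subseteq> \<C> \<and> \<Union>?\<B> \<subseteq> \<Union>\<D>"
    using HK unfolding \<B> A_def B_def
    by (intro exI[of _ "stone_map ` K \<union> ?compl ` H"]) auto
qed

lemma openin_dual_pts_trace:
  assumes "finite H"
  shows "openin priestley_top {Q \<in> dual_pts. Q \<inter> H = P \<inter> H}"
  using assms
proof (induction H)
  case empty
  then show ?case
    using openin_topspace[of priestley_top] by (simp add: topspace_priestley_top)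
next
  case (insert a H)
  have "openin priestley_top {Q \<in> dual_pts. a \<in> Q \<longleftrightarrow> a \<in> P}"
    using openin_stone_map[of a] openin_Diff_stone_map[of a]
    by (cases "a \<in> P")
      (auto simp: stone_map_def set_diff_eq Collect_conj_eq[symmetric] cong: conj_cong)
  moreover have "{Q \<in> dual_pts. Q \<inter> insert a H = P \<inter> insert a H}
      = {Q \<in> dual_pts. a \<in> Q \<longleftrightarrow> a \<in> P} \<inter> {Q \<in> dual_pts. Q \<inter> H = P \<inter> H}"
    using \<open>a \<notin> H\<close> by blast
  ultimately show ?case using insert.IH by (simp add: openin_Int)
qed

lemma closure_of_priestley_top_pt: "P \<in> priestley_top closure_of S \<Longrightarrow> P \<in> dual_pts"
  by (simp add: in_closure_of topspace_priestley_top)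

lemma closure_of_priestley_top_trace:
  assumes "P \<in> priestley_top closure_of S" "finite H"
  obtains t where "t \<in> S" "t \<inter> H = P \<inter> H"
proof -
  have "\<exists>t. t \<in> S \<and> t \<in> {Q \<in> dual_pts. Q \<inter> H = P \<inter> H}"
    using assms(1) openin_dual_pts_trace[OF assms(2), of P] closure_of_priestley_top_pt[OF assms(1)]
    unfolding in_closure_of by (metis (mono_tags, lifting) mem_Collect_eq)
  then show thesis using that by blast
qed

lemma closedin_priestley_top_not_mem: "closedin priestley_top {t \<in> dual_pts. a \<notin> t}"
proof -
  have "{t \<in> dual_pts. a \<notin> t} = dual_pts - stone_map a"
    unfolding stone_map_def by blast
  then show ?thesis
    by (metis closedin_diff closedin_topspace openin_stone_map topspace_priestley_top)
qed

lemma closedin_priestley_top_downset: "closedin priestley_top {t \<in> dual_pts. t \<subseteq> x}"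
proof (cases "x = UNIV")
  case True
  then show ?thesis
    using closedin_topspace[of priestley_top] by (simp add: topspace_priestley_top)
next
  case False
  have "closedin priestley_top (\<Inter>a\<in>- x. {t \<in> dual_pts. a \<notin> t})"
    using False closedin_priestley_top_not_mem by (intro closedin_INT) auto
  moreover have "(\<Inter>a\<in>- x. {t \<in> dual_pts. a \<notin> t}) = {t \<in> dual_pts. t \<subseteq> x}"
    using False by blast
  ultimately show ?thesis by simp
qed

lemma compact_space_directed_closures:
  assumes "compact_space X" "I \<noteq> {}" "\<And>i. i \<in> I \<Longrightarrow> S i \<noteq> {} \<and> S i \<subseteq> topspace X"
    and directed: "\<And>i j. i \<in> I \<Longrightarrow> j \<in> I \<Longrightarrow> \<exists>k\<in>I. S k \<subseteq> S i \<inter> S j"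
  shows "\<exists>p. \<forall>i\<in>I. p \<in> X closure_of S i"
proof -
  have lower: "\<exists>k\<in>I. \<forall>j\<in>J. S k \<subseteq> S j" if "finite J" "J \<subseteq> I" for J
    using that
  proof (induction J)
    case empty
    then show ?case using assms(2) by blast
  next
    case (insert i J)
    then obtain j where "j \<in> I" "\<forall>l\<in>J. S j \<subseteq> S l" by auto
    moreover obtain k where "k \<in> I" "S k \<subseteq> S i \<inter> S j"
      using directed[of i j] insert.prems \<open>j \<in> I\<close> by blast
    ultimately show ?case by (intro bexI[of _ k]) auto
  qed
  have "\<Inter>\<F> \<noteq> {}" if "finite \<F>" "\<F> \<subseteq> (\<lambda>i. X closure_of S i) ` I" for \<F>
  proof -
    obtain J where J: "finite J" "J \<subseteq> I" "\<F> = (\<lambda>i. X closure_of S i) ` J"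
      using finite_subset_image[OF \<open>finite \<F>\<close> \<open>\<F> \<subseteq> _\<close>] by blast
    then obtain k where "k \<in> I" "\<forall>j\<in>J. S k \<subseteq> S j" using lower by blast
    have "S k \<subseteq> X closure_of S j" if "j \<in> J" for j
    proof -
      have "S j \<subseteq> X closure_of S j" using assms(3) J(2) that by (intro closure_of_subset) blast
      then show ?thesis using \<open>\<forall>j\<in>J. S k \<subseteq> S j\<close> that by blast
    qed
    moreover obtain p where "p \<in> S k" using assms(3)[OF \<open>k \<in> I\<close>] by blast
    ultimately have "p \<in> \<Inter>\<F>" using J(3) by auto
    then show ?thesis by blast
  qed
  then have "\<Inter>((\<lambda>i. X closure_of S i) ` I) \<noteq> {}"
    using assms(1)[unfolded compact_space_fip]
    by (metis (no_types, lifting) closedin_closure_of imageE)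
  then show ?thesis by blast
qed

lemma directed_traces_of_cluster_points:
  assumes "finite H" "I \<noteq> {}" "\<And>i. i \<in> I \<Longrightarrow> S i \<subseteq> dual_pts"
    and directed: "\<And>i j. i \<in> I \<Longrightarrow> j \<in> I \<Longrightarrow> \<exists>k\<in>I. S k \<subseteq> S i \<inter> S j"
    and cluster: "\<And>P. (\<And>i. i \<in> I \<Longrightarrow> P \<in> priestley_top closure_of S i) \<Longrightarrow> P \<in> T"
  shows "\<exists>i\<in>I. (\<lambda>t. t \<inter> H) ` S i \<subseteq> (\<lambda>t. t \<inter> H) ` T"
proof (rule ccontr)
  assume none: "\<not> ?thesis"
  define S' where "S' i = {t \<in> S i. t \<inter> H \<notin> (\<lambda>t. t \<inter> H) ` T}" for i
  have "\<exists>P. \<forall>i\<in>I. P \<in> priestley_top closure_of S' i"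
  proof (rule compact_space_directed_closures[OF compact_space_priestley_top assms(2)])
    show "S' i \<noteq> {} \<and> S' i \<subseteq> topspace priestley_top" if "i \<in> I" for i
      using none assms(3)[OF that] that unfolding S'_def topspace_priestley_top by blast
    show "\<exists>k\<in>I. S' k \<subseteq> S' i \<inter> S' j" if "i \<in> I" "j \<in> I" for i j
      using directed[OF that] unfolding S'_def by blast
  qed
  then obtain P where P: "\<And>i. i \<in> I \<Longrightarrow> P \<in> priestley_top closure_of S' i" by blast
  have "P \<in> T"
    using P closure_of_mono[of "S' _" "S _" priestley_top] unfolding S'_def
    by (intro cluster) blast
  moreover obtain i where "i \<in> I" using assms(2) by blast
  then obtain t where "t \<in> S' i" "t \<inter> H = P \<inter> H"
    using P closure_of_priestley_top_trace assms(1) by metis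
  ultimately show False unfolding S'_def by blast
qed

definition finitely_determined :: "('a::{distrib_lattice,bounded_lattice} set \<Rightarrow> 'b) \<Rightarrow> bool" where
  "finitely_determined f \<longleftrightarrow>
     (\<exists>H. finite H \<and> (\<forall>P\<in>dual_pts. \<forall>Q\<in>dual_pts. P \<inter> H = Q \<inter> H \<longrightarrow> f P = f Q))"

lemma finitely_determinedE:
  assumes "finitely_determined f"
  obtains H where "finite H"
    and "\<And>P Q. P \<in> dual_pts \<Longrightarrow> Q \<in> dual_pts \<Longrightarrow> P \<inter> H = Q \<inter> H \<Longrightarrow> f P = f Q"
  using assms unfolding finitely_determined_def by auto

lemma finitely_determined_const: "finitely_determined (\<lambda>P. c)"
  unfolding finitely_determined_def by blast

lemma finitely_determined_mem: "finitely_determined (\<lambda>P. a \<in> P)"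
  unfolding finitely_determined_def by (rule exI[of _ "{a}"]) blast

lemma finitely_determined_compose2:
  assumes "finitely_determined f" "finitely_determined g"
  shows "finitely_determined (\<lambda>P. h (f P) (g P))"
proof -
  obtain F where F: "finite F"
    "\<And>P Q. P \<in> dual_pts \<Longrightarrow> Q \<in> dual_pts \<Longrightarrow> P \<inter> F = Q \<inter> F \<Longrightarrow> f P = f Q"
    using assms(1) by (rule finitely_determinedE) (rule that)
  obtain G where G: "finite G"
    "\<And>P Q. P \<in> dual_pts \<Longrightarrow> Q \<in> dual_pts \<Longrightarrow> P \<inter> G = Q \<inter> G \<Longrightarrow> g P = g Q"
    using assms(2) by (rule finitely_determinedE) (rule that)
  have "h (f P) (g P) = h (f Q) (g Q)"
    if PQ: "P \<in> dual_pts" "Q \<in> dual_pts" "P \<inter> (F \<union> G) = Q \<inter> (F \<union> G)" for P Q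
  proof -
    have "P \<inter> F = Q \<inter> F" "P \<inter> G = Q \<inter> G" using PQ(3) by auto
    then show ?thesis using F(2) G(2) PQ(1,2) by metis
  qed
  then show ?thesis
    unfolding finitely_determined_def using F(1) G(1) by (intro exI[of _ "F \<union> G"]) blast
qed

lemma finitely_determined_if:
  assumes "finitely_determined b" "finitely_determined f" "finitely_determined g"
  shows "finitely_determined (\<lambda>P. if b P then f P else g P)"
  using finitely_determined_compose2[OF finitely_determined_compose2[OF assms(1,2)] assms(3),
      where h = "\<lambda>(b, x) y. if b then x else y" and h1 = Pair] by simp

lemma finitely_determined_compose:
  "finitely_determined f \<Longrightarrow> finitely_determined (\<lambda>P. h (f P))"
  unfolding finitely_determined_def by metis

lemma finitely_determined_cong:
  assumes "\<And>P. P \<in> dual_pts \<Longrightarrow> f P = g P" "finitely_determined f"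
  shows "finitely_determined g"
  using assms unfolding finitely_determined_def by metis

lemma continuous_map_finitely_determined:
  assumes "finitely_determined f" "f ` dual_pts \<subseteq> Y"
  shows "continuous_map priestley_top (discrete_topology Y) f"
proof -
  obtain H where H: "finite H"
    and det: "\<And>P Q. P \<in> dual_pts \<Longrightarrow> Q \<in> dual_pts \<Longrightarrow> P \<inter> H = Q \<inter> H \<Longrightarrow> f P = f Q"
    using assms(1) by (rule finitely_determinedE) (rule that)
  have "openin priestley_top {P \<in> dual_pts. f P \<in> U}" for U
  proof (subst openin_subopen, intro ballI)
    fix P assume P: "P \<in> {P \<in> dual_pts. f P \<in> U}"
    have "f Q \<in> U" if "Q \<in> dual_pts" "Q \<inter> H = P \<inter> H" for Q
      using det[of Q P] that P by simp
    then have "{Q \<in> dual_pts. Q \<inter> H = P \<inter> H} \<subseteq> {P \<in> dual_pts. f P \<in> U}"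
      by blast
    then show "\<exists>T. openin priestley_top T \<and> P \<in> T \<and> T \<subseteq> {P \<in> dual_pts. f P \<in> U}"
      using openin_dual_pts_trace[OF H, of P] P by blast
  qed
  then show ?thesis
    using assms(2) unfolding continuous_map topspace_priestley_top by simp
qed

lemma maps_ontoI:
  fixes f :: "'a::{distrib_lattice,bounded_lattice} set \<Rightarrow> nat"
  assumes "finitely_determined f" "f ` dual_pts = Y" "bi_p_morphism f dual_pts (\<subseteq>) Y leY"
  shows "maps_onto TYPE('a) Y leY"
  using assms continuous_map_finitely_determined[of f Y] unfolding maps_onto_def by blast

lemma
  assumes "bi_p_morphism f X leX Y leY" "x \<in> X"
  shows bi_p_morphism_in: "f x \<in> Y"
    and bi_p_morphism_mono: "x' \<in> X \<Longrightarrow> leX x x' \<Longrightarrow> leY (f x) (f x')"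
    and bi_p_morphism_up: "y \<in> Y \<Longrightarrow> leY (f x) y \<Longrightarrow> \<exists>x'\<in>X. leX x x' \<and> f x' = y"
    and bi_p_morphism_down: "y \<in> Y \<Longrightarrow> leY y (f x) \<Longrightarrow> \<exists>x'\<in>X. leX x' x \<and> f x' = y"
  using assms unfolding bi_p_morphism_def by auto

lemma bi_p_morphism_comp:
  assumes f: "bi_p_morphism f X leX Y leY" and g: "bi_p_morphism g Y leY Z leZ"
  shows "bi_p_morphism (\<lambda>x. g (f x)) X leX Z leZ"
  unfolding bi_p_morphism_def
proof (intro conjI ballI impI subsetI)
  show "z \<in> Z" if "z \<in> (\<lambda>x. g (f x)) ` X" for z
    using that bi_p_morphism_in[OF f] bi_p_morphism_in[OF g] by blast
  show "leZ (g (f x)) (g (f x'))" if "x \<in> X" "x' \<in> X" "leX x x'" for x x'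
    using that bi_p_morphism_mono[OF f] bi_p_morphism_mono[OF g] bi_p_morphism_in[OF f] by simp
  show "\<exists>x'\<in>X. leX x x' \<and> g (f x') = z" if x: "x \<in> X" "z \<in> Z" "leZ (g (f x)) z" for x z
    using bi_p_morphism_up[OF g bi_p_morphism_in[OF f x(1)] x(2,3)] bi_p_morphism_up[OF f x(1)]
    by metis
  show "\<exists>x'\<in>X. leX x' x \<and> g (f x') = z" if x: "x \<in> X" "z \<in> Z" "leZ z (g (f x))" for x z
    using bi_p_morphism_down[OF g bi_p_morphism_in[OF f x(1)] x(2,3)] bi_p_morphism_down[OF f x(1)]
    by metis
qed

section \<open>Bi-Heyting algebras and bisimulations of their duals\<close>

lemma minimal_pt: "t \<in> minimals \<Longrightarrow> t \<in> dual_pts"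
  unfolding minimals_def by blast

lemma minimal_eq: "t \<in> minimals \<Longrightarrow> y \<in> dual_pts \<Longrightarrow> y \<subseteq> t \<Longrightarrow> y = t"
  unfolding minimals_def by blast

locale bi_heyting_algebra =
  fixes imp coimp :: "'a::{distrib_lattice,bounded_lattice} \<Rightarrow> 'a \<Rightarrow> 'a"
  assumes bi_heyting: "bi_heyting imp coimp"
begin

lemma le_imp_iff: "c \<le> imp a b \<longleftrightarrow> inf c a \<le> b"
  and coimp_le_iff: "coimp a b \<le> c \<longleftrightarrow> a \<le> sup b c"
  using bi_heyting by (simp_all add: bi_heyting_def)

lemma imp_mem_iff:
  assumes x: "x \<in> dual_pts"
  shows "imp a b \<in> x \<longleftrightarrow> (\<forall>y\<in>dual_pts. x \<subseteq> y \<longrightarrow> a \<in> y \<longrightarrow> b \<in> y)"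
proof
  assume "imp a b \<in> x"
  moreover have "inf (imp a b) a \<le> b" using le_imp_iff by blast
  ultimately show "\<forall>y\<in>dual_pts. x \<subseteq> y \<longrightarrow> a \<in> y \<longrightarrow> b \<in> y"
    by (meson dual_pts_inf_iff dual_pts_upward in_mono)
next
  assume implies: "\<forall>y\<in>dual_pts. x \<subseteq> y \<longrightarrow> a \<in> y \<longrightarrow> b \<in> y"
  note filter = lattice_filter_dual_pts[OF x]
  show "imp a b \<in> x"
  proof (rule ccontr)
    assume "imp a b \<notin> x"
    then have "\<not> inf d a \<le> b" if "d \<in> x" for d
      using that dual_pts_upward[OF x] le_imp_iff by blast
    then have "filter_adjoin x a \<inter> {..b} = {}"
      unfolding filter_adjoin_def by (auto dest: order_trans)
    then obtain y where "y \<in> dual_pts" "filter_adjoin x a \<subseteq> y" "y \<inter> {..b} = {}"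
      by (rule prime_filter_separation[OF lattice_filter_adjoin[OF filter] lattice_ideal_atMost])
    then show False
      using implies subset_filter_adjoin[of x a] mem_filter_adjoin[OF filter, of a] by blast
  qed
qed

lemma coimp_mem_iff:
  assumes x: "x \<in> dual_pts"
  shows "coimp a b \<in> x \<longleftrightarrow> (\<exists>y\<in>dual_pts. y \<subseteq> x \<and> a \<in> y \<and> b \<notin> y)"
proof
  assume "\<exists>y\<in>dual_pts. y \<subseteq> x \<and> a \<in> y \<and> b \<notin> y"
  then obtain y where y: "y \<in> dual_pts" "y \<subseteq> x" "a \<in> y" "b \<notin> y" by blast
  have "a \<le> sup b (coimp a b)" using coimp_le_iff by blast
  then show "coimp a b \<in> x" using y dual_pts_sup_iff dual_pts_upward by blast
next
  assume mem: "coimp a b \<in> x"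
  note ideal = lattice_ideal_Compl_dual_pts[OF x]
  have "{a..} \<inter> ideal_adjoin (- x) b = {}"
    using mem dual_pts_upward[OF x] unfolding ideal_adjoin_def
    by (auto simp: coimp_le_iff sup_commute dest: order_trans)
  then obtain y where "y \<in> dual_pts" "{a..} \<subseteq> y" "y \<inter> ideal_adjoin (- x) b = {}"
    by (rule prime_filter_separation[OF lattice_filter_atLeast lattice_ideal_adjoin[OF ideal]])
  then show "\<exists>y\<in>dual_pts. y \<subseteq> x \<and> a \<in> y \<and> b \<notin> y"
    using subset_ideal_adjoin[of "- x" b] mem_ideal_adjoin[OF ideal, of b] by blast
qed

lemma minimals_iff:
  "y \<in> minimals \<longleftrightarrow> y \<in> dual_pts \<and> (\<forall>a. inf a (coimp top a) \<notin> y)"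
proof -
  have "(\<exists>a. inf a (coimp top a) \<in> y) \<longleftrightarrow> (\<exists>z\<in>dual_pts. z \<subset> y)" if y: "y \<in> dual_pts"
  proof -
    have "inf a (coimp top a) \<in> y \<longleftrightarrow> a \<in> y \<and> (\<exists>z\<in>dual_pts. z \<subseteq> y \<and> a \<notin> z)" for a
      using dual_pts_top by (auto simp: dual_pts_inf_iff[OF y] coimp_mem_iff[OF y])
    then show ?thesis by (simp add: psubset_eq) blast
  qed
  then show ?thesis unfolding minimals_def by blast
qed

lemma nonminimal_witness:
  fixes x :: "'a set"
  assumes "x \<in> dual_pts" "x \<notin> minimals"
  obtains u where "u \<in> x" "\<And>y. y \<in> minimals \<Longrightarrow> u \<notin> y"
proof -
  obtain a where "inf a (coimp top a) \<in> x" using assms minimals_iff by blast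
  then show thesis using that minimals_iff by blast
qed

lemma closedin_minimals: "closedin priestley_top (minimals :: 'a set set)"
proof -
  have "closedin priestley_top (\<Inter>a. {t \<in> dual_pts. inf a (coimp top a) \<notin> t})"
    using closedin_priestley_top_not_mem by (intro closedin_INT) auto
  moreover have "(\<Inter>a. {t \<in> dual_pts. inf a (coimp top a) \<notin> t}) = minimals"
    using minimals_iff by blast
  ultimately show ?thesis by simp
qed

lemma closure_of_minimals_below:
  fixes x :: "'a set"
  assumes "P \<in> priestley_top closure_of S" "S \<subseteq> {t \<in> minimals. t \<subseteq> x}"
  shows "P \<in> minimals" "P \<subseteq> x"
proof -
  have "priestley_top closure_of S \<subseteq> minimals \<inter> {t \<in> dual_pts. t \<subseteq> x}"
    using assms(2) minimal_pt
    by (intro closure_of_minimal closedin_Int closedin_minimals closedin_priestley_top_downset) blast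
  then show "P \<in> minimals" "P \<subseteq> x" using assms(1) by auto
qed

definition bisimulation :: "'a set \<Rightarrow> ('a set \<Rightarrow> 'a set \<Rightarrow> bool) \<Rightarrow> bool" where
  "bisimulation G R \<longleftrightarrow> symp R \<and> (\<forall>x y. R x y \<longrightarrow>
     x \<in> dual_pts \<and> y \<in> dual_pts \<and> x \<inter> G = y \<inter> G \<and>
     (\<forall>u\<in>dual_pts. x \<subseteq> u \<longrightarrow> (\<exists>v\<in>dual_pts. y \<subseteq> v \<and> R\<^sup>=\<^sup>= u v)) \<and>
     (\<forall>u\<in>dual_pts. u \<subseteq> x \<longrightarrow> (\<exists>v\<in>dual_pts. v \<subseteq> y \<and> R\<^sup>=\<^sup>= u v)))"

lemma bisimulationI:
  assumes "\<And>x y. R x y \<Longrightarrow> R y x"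
    and "\<And>x y. R x y \<Longrightarrow> x \<in> dual_pts"
    and "\<And>x y. R x y \<Longrightarrow> x \<inter> G = y \<inter> G"
    and "\<And>x y u. R x y \<Longrightarrow> u \<in> dual_pts \<Longrightarrow> x \<subseteq> u \<Longrightarrow> \<exists>v\<in>dual_pts. y \<subseteq> v \<and> R\<^sup>=\<^sup>= u v"
    and "\<And>x y u. R x y \<Longrightarrow> u \<in> dual_pts \<Longrightarrow> u \<subseteq> x \<Longrightarrow> \<exists>v\<in>dual_pts. v \<subseteq> y \<and> R\<^sup>=\<^sup>= u v"
  shows "bisimulation G R"
  unfolding bisimulation_def symp_def using assms by meson

lemma
  assumes "bisimulation G R" "R x y"
  shows bisimulation_sym: "R y x" and bisimulation_pts: "x \<in> dual_pts" "y \<in> dual_pts"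
    and bisimulation_trace: "x \<inter> G = y \<inter> G"
    and bisimulation_up: "u \<in> dual_pts \<Longrightarrow> x \<subseteq> u \<Longrightarrow> \<exists>v\<in>dual_pts. y \<subseteq> v \<and> R\<^sup>=\<^sup>= u v"
    and bisimulation_down: "u \<in> dual_pts \<Longrightarrow> u \<subseteq> x \<Longrightarrow> \<exists>v\<in>dual_pts. v \<subseteq> y \<and> R\<^sup>=\<^sup>= u v"
  using assms unfolding bisimulation_def by (metis sympD)+

lemma bisimulation_preserves_generated:
  assumes R: "bisimulation G R"
  shows "a \<in> bh_generated imp coimp G \<Longrightarrow> R x y \<Longrightarrow> a \<in> x \<Longrightarrow> a \<in> y"
proof (induction arbitrary: x y rule: bh_generated.induct)
  case (gen a)
  then show ?case using bisimulation_trace[OF R] by blast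
next
  case (imp a b)
  note xy = imp.prems(1) bisimulation_pts[OF R imp.prems(1)]
  have "b \<in> v" if v: "v \<in> dual_pts" "y \<subseteq> v" "a \<in> v" for v
  proof -
    obtain u where u: "u \<in> dual_pts" "x \<subseteq> u" "R\<^sup>=\<^sup>= v u"
      using bisimulation_up[OF R bisimulation_sym[OF R xy(1)] v(1,2)] by blast
    have "a \<in> u" using u(3) v(3) imp.IH(1) by auto
    then have "b \<in> u" using u imp.prems(2) imp_mem_iff[OF xy(2)] by blast
    then show ?thesis using u(3) imp.IH(2) bisimulation_sym[OF R] by auto
  qed
  then show ?case using imp_mem_iff[OF xy(3)] by blast
next
  case (coimp a b)
  note xy = coimp.prems(1) bisimulation_pts[OF R coimp.prems(1)]
  obtain u where u: "u \<in> dual_pts" "u \<subseteq> x" "a \<in> u" "b \<notin> u"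
    using coimp.prems(2) coimp_mem_iff[OF xy(2)] by blast
  obtain v where v: "v \<in> dual_pts" "v \<subseteq> y" "R\<^sup>=\<^sup>= u v"
    using bisimulation_down[OF R xy(1) u(1,2)] by blast
  have "a \<in> v" using u(3) v(3) coimp.IH(1) by auto
  moreover have "b \<notin> v" using u(4) v(3) coimp.IH(2)[OF bisimulation_sym[OF R]] by auto
  ultimately show ?case using v coimp_mem_iff[OF xy(3)] by blast
next
  case (inf a b)
  then show ?case using bisimulation_pts[OF R inf.prems(1)] by (auto simp: dual_pts_inf_iff)
next
  case (sup a b)
  then show ?case using bisimulation_pts[OF R sup.prems(1)] by (auto simp: dual_pts_sup_iff)
qed (auto simp: dual_pts_top dual_pts_bot dest: bisimulation_pts[OF R])

lemma bisimulation_imp_eq: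
  assumes "bh_generated imp coimp G = UNIV" "bisimulation G R" "R x y"
  shows "x = y"
  using bisimulation_preserves_generated[OF assms(2)] bisimulation_sym[OF assms(2,3)] assms(1,3)
  by blast

lemma upper_chain:
  fixes y :: "'a set"
  assumes "validates_biLC imp" and y: "y \<in> dual_pts"
    and c: "c \<in> dual_pts" "y \<subseteq> c" and d: "d \<in> dual_pts" "y \<subseteq> d"
  shows "c \<subseteq> d \<or> d \<subseteq> c"
proof (rule ccontr)
  assume "\<not> ?thesis"
  then obtain a b where ab: "a \<in> c" "a \<notin> d" "b \<in> d" "b \<notin> c" by blast
  have "sup (imp a b) (imp b a) \<in> y"
    using assms(1) dual_pts_top[OF y] unfolding validates_biLC_def by simp
  then have "imp a b \<in> y \<or> imp b a \<in> y" using dual_pts_sup_iff[OF y] by simp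
  then show False using imp_mem_iff[OF y] c d ab by blast
qed

end

section \<open>Combs: a chain with further minimal points hanging below it\<close>

lemma imm_predD:
  assumes "imm_pred z x"
  shows imm_pred_pts: "z \<in> dual_pts" "x \<in> dual_pts" and imm_pred_less: "z \<subset> x"
    and imm_pred_no_between: "w \<in> dual_pts \<Longrightarrow> z \<subset> w \<Longrightarrow> \<not> w \<subset> x"
  using assms unfolding imm_pred_def by auto

locale comb = bi_heyting_algebra imp coimp
  for imp coimp :: "'a::{distrib_lattice,bounded_lattice} \<Rightarrow> 'a \<Rightarrow> 'a" +
  fixes m r :: "'a set"
  assumes biLC: "validates_biLC imp"
    and r_pt: "r \<in> dual_pts" and le_r: "x \<in> dual_pts \<Longrightarrow> x \<subseteq> r"
    and m_min: "m \<in> minimals"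
    and above_m_or_minimal: "x \<in> dual_pts \<Longrightarrow> m \<subset> x \<or> x \<in> minimals"
begin

definition spine :: "'a set set" where
  "spine = {x \<in> dual_pts. m \<subset> x}"

lemma m_pt: "m \<in> dual_pts"
  using minimal_pt[OF m_min] .

lemma spine_pt: "x \<in> spine \<Longrightarrow> x \<in> dual_pts"
  and m_less_spine: "x \<in> spine \<Longrightarrow> m \<subset> x"
  unfolding spine_def by blast+

lemma up_set_eq: "up_set m = insert m spine"
  using m_pt unfolding up_set_def spine_def by blast

lemma spine_or_minimal: "x \<in> dual_pts \<Longrightarrow> x \<in> spine \<or> x \<in> minimals"
  using above_m_or_minimal unfolding spine_def by blast

lemma spine_not_minimal: "x \<in> spine \<Longrightarrow> x \<notin> minimals"
  using m_pt unfolding minimals_def spine_def by blast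

lemma spine_upward: "x \<in> spine \<Longrightarrow> q \<in> dual_pts \<Longrightarrow> x \<subseteq> q \<Longrightarrow> q \<in> spine"
  unfolding spine_def by blast

lemma above_minimal_spine: "t \<in> minimals \<Longrightarrow> q \<in> dual_pts \<Longrightarrow> t \<subset> q \<Longrightarrow> q \<in> spine"
  using spine_or_minimal minimal_eq[of q t] minimal_pt by blast

lemma up_set_linear: "c \<in> up_set m \<Longrightarrow> d \<in> up_set m \<Longrightarrow> c \<subseteq> d \<or> d \<subseteq> c"
  using upper_chain[OF biLC m_pt] unfolding up_set_def by blast

lemma spine_linear: "c \<in> spine \<Longrightarrow> d \<in> spine \<Longrightarrow> c \<subseteq> d \<or> d \<subseteq> c"
  using up_set_linear up_set_eq by blast

lemma subset_chain_spine: "Q \<subseteq> spine \<Longrightarrow> subset.chain dual_pts Q"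
  using spine_linear spine_pt unfolding subset_chain_def by blast

lemma imm_pred_above:
  fixes z :: "'a set"
  assumes "imm_pred z x" "w \<in> dual_pts" "z \<subset> w"
  shows "x \<subseteq> w"
proof -
  have "x \<subseteq> w \<or> w \<subseteq> x"
    using upper_chain[OF biLC, of z x w] imm_predD(1-3)[OF assms(1)] assms(2,3) by auto
  then show ?thesis using imm_pred_no_between[OF assms] by blast
qed

text \<open>The minimal points that hang from the spine at a point between \<open>a\<close> and \<open>b\<close>.\<close>

definition teeth :: "'a set \<Rightarrow> 'a set \<Rightarrow> 'a set set" where
  "teeth a b = {t \<in> minimals. t \<subseteq> b \<and> (\<forall>q\<in>spine. t \<subseteq> q \<longrightarrow> a \<subseteq> q)}"

lemma teethD:
  assumes "t \<in> teeth a b"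
  shows "t \<in> minimals" "t \<in> dual_pts" "t \<subseteq> b" "q \<in> spine \<Longrightarrow> t \<subseteq> q \<Longrightarrow> a \<subseteq> q"
  using assms minimal_pt unfolding teeth_def by auto

lemma mem_teeth_self_iff:
  assumes x: "x \<in> spine"
  shows "t \<in> teeth x x \<longleftrightarrow> t \<in> minimals \<and> imm_pred t x"
proof (intro iffI conjI; (elim conjE)?)
  assume t: "t \<in> teeth x x"
  then show "t \<in> minimals" by (rule teethD)
  have "t \<subset> x" using teethD(1,3)[OF t] spine_not_minimal[OF x] by blast
  moreover have "\<not> w \<subset> x" if "w \<in> dual_pts" "t \<subset> w" for w
    using teethD(4)[OF t above_minimal_spine[OF teethD(1)[OF t] that]] that(2) by blast
  ultimately show "imm_pred t x"
    using spine_pt[OF x] teethD(2)[OF t] unfolding imm_pred_def by blast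
next
  assume t: "t \<in> minimals" "imm_pred t x"
  have "x \<subseteq> q" if "q \<in> spine" "t \<subseteq> q" for q
    using imm_pred_above[OF t(2) spine_pt[OF that(1)]] spine_not_minimal[OF that(1)] that(2) t(1)
    by blast
  then show "t \<in> teeth x x" using t imm_pred_less[OF t(2)] unfolding teeth_def by blast
qed

lemma teeth_segment_iff:
  assumes "a \<in> spine" "t \<in> minimals" "\<not> t \<subseteq> a"
  shows "t \<in> teeth a b \<longleftrightarrow> t \<subseteq> b"
  using spine_linear[OF assms(1)] assms(2,3) unfolding teeth_def by blast

text \<open>Choose \<open>e \<in> q\<close> that lies in no minimal point, and suppose \<open>f \<in> c - q\<close>. Every minimal point not
  below \<open>c\<close> contains \<open>imp e f\<close>, hence so does the limit \<open>P\<close>, but then \<open>P \<subseteq> q\<close> fails.\<close>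

lemma closure_of_teeth_above:
  assumes c: "c \<in> spine" and q: "q \<in> spine"
    and P: "P \<in> priestley_top closure_of {t \<in> minimals. \<not> t \<subseteq> c}" "P \<subseteq> q"
  shows "c \<subseteq> q"
proof (rule ccontr)
  assume "\<not> c \<subseteq> q"
  then obtain f where f: "f \<in> c" "f \<notin> q" by blast
  obtain e where e: "e \<in> q" "\<And>y. y \<in> minimals \<Longrightarrow> e \<notin> y"
    using nonminimal_witness[OF spine_pt[OF q] spine_not_minimal[OF q]] by blast
  have "imp e f \<in> t" if t: "t \<in> minimals" "\<not> t \<subseteq> c" for t
  proof -
    have "f \<in> g" if g: "g \<in> dual_pts" "t \<subseteq> g" "e \<in> g" for g
    proof -
      have "g \<in> spine" using spine_or_minimal[OF g(1)] e(2) g(3) by blast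
      then have "c \<subseteq> g" using spine_linear[OF c, of g] g(2) t(2) by blast
      then show ?thesis using f(1) by blast
    qed
    then show ?thesis using imp_mem_iff[OF minimal_pt[OF t(1)]] by blast
  qed
  moreover obtain t where "t \<in> {t \<in> minimals. \<not> t \<subseteq> c}" "t \<inter> {imp e f} = P \<inter> {imp e f}"
    using closure_of_priestley_top_trace[OF P(1), of "{imp e f}"] by auto
  ultimately have "imp e f \<in> P" by blast
  moreover have "P \<in> dual_pts"
    using closure_of_priestley_top_pt[OF P(1)] .
  ultimately show False
    using imp_mem_iff[of P e f] spine_pt[OF q] P(2) e(1) f(2) by blast
qed

lemma spine_successor_cases: "imm_pred z x \<Longrightarrow> z \<in> up_set m \<Longrightarrow> q \<in> spine \<Longrightarrow> x \<subseteq> q \<or> q \<subseteq> z"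
  using up_set_linear[of q z] imm_pred_above[of z x q] spine_pt[of q] up_set_eq by blast

lemma successor_in_spine: "imm_pred z x \<Longrightarrow> z \<in> up_set m \<Longrightarrow> x \<in> spine"
  using imm_predD(2,3)[of z x] unfolding up_set_def spine_def by blast

lemma successor_upset_witness:
  assumes zx: "imm_pred z x" and z: "z \<in> up_set m"
  shows "\<exists>u. \<forall>q\<in>dual_pts. u \<in> q \<longleftrightarrow> x \<subseteq> q"
proof -
  note x = successor_in_spine[OF zx z]
  obtain u1 where u1: "u1 \<in> x" "\<And>y. y \<in> minimals \<Longrightarrow> u1 \<notin> y"
    using nonminimal_witness[OF spine_pt[OF x] spine_not_minimal[OF x]] by blast
  obtain u2 where u2: "u2 \<in> x" "u2 \<notin> z" using imm_pred_less[OF zx] by blast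
  have "inf u1 u2 \<in> q \<longleftrightarrow> x \<subseteq> q" if q: "q \<in> dual_pts" for q
  proof
    assume "inf u1 u2 \<in> q"
    then show "x \<subseteq> q"
      using dual_pts_inf_iff[OF q] u1(2) u2(2) spine_or_minimal[OF q]
        spine_successor_cases[OF zx z, of q] by blast
  next
    assume "x \<subseteq> q"
    then show "inf u1 u2 \<in> q" using dual_pts_inf_iff[OF q] u1(1) u2(1) by blast
  qed
  then show ?thesis by blast
qed

lemma spine_downset_witness:
  assumes zx: "imm_pred z x" and z: "z \<in> spine"
    and u: "\<And>q. q \<in> dual_pts \<Longrightarrow> u \<in> q \<longleftrightarrow> x \<subseteq> q"
    and v: "v \<in> z" "\<And>y. y \<in> minimals \<Longrightarrow> v \<notin> y"
    and p: "p \<in> dual_pts"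
  shows "imp v u \<in> p \<longleftrightarrow> \<not> p \<subseteq> z"
proof
  assume "imp v u \<in> p"
  then show "\<not> p \<subseteq> z"
    using imp_mem_iff[OF p] spine_pt[OF z] v(1) u imm_pred_less[OF zx] by blast
next
  assume np: "\<not> p \<subseteq> z"
  have "u \<in> w" if w: "w \<in> dual_pts" "p \<subseteq> w" "v \<in> w" for w
    using spine_or_minimal[OF w(1)] spine_successor_cases[OF zx, of w] v(2) w z np u[OF w(1)]
      up_set_eq by blast
  then show "imp v u \<in> p" using imp_mem_iff[OF p] by blast
qed

lemma finitely_determined_successor_upset:
  assumes "imm_pred z x" "z \<in> up_set m"
  shows "finitely_determined (\<lambda>p. x \<subseteq> p)"
proof -
  obtain u where u: "\<And>q. q \<in> dual_pts \<Longrightarrow> u \<in> q \<longleftrightarrow> x \<subseteq> q"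
    using successor_upset_witness[OF assms] by blast
  show ?thesis
    using finitely_determined_cong[OF u finitely_determined_mem] .
qed

lemma finitely_determined_spine_downset:
  assumes zx: "imm_pred z x" and z: "z \<in> spine"
  shows "finitely_determined (\<lambda>p. p \<subseteq> z)"
proof -
  have "z \<in> up_set m" using z up_set_eq by simp
  then obtain u where u: "\<And>q. q \<in> dual_pts \<Longrightarrow> u \<in> q \<longleftrightarrow> x \<subseteq> q"
    using successor_upset_witness[OF zx] by metis
  obtain v where v: "v \<in> z" "\<And>y. y \<in> minimals \<Longrightarrow> v \<notin> y"
    using nonminimal_witness[OF spine_pt[OF z] spine_not_minimal[OF z]] by blast
  have "(\<not> imp v u \<in> p) = (p \<subseteq> z)" if "p \<in> dual_pts" for p
    using spine_downset_witness[OF zx z u v that] by simp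
  then show ?thesis
    using finitely_determined_compose[OF finitely_determined_mem, of Not]
    by (rule finitely_determined_cong)
qed

section \<open>Bi-p-morphisms onto the forbidden co-trees\<close>

lemma maps_onto_F3I:
  fixes g :: "'a set \<Rightarrow> nat"
  assumes x: "x \<in> dual_pts" "finitely_determined (\<lambda>p. x \<subseteq> p)"
    and g: "finitely_determined g" "\<And>p. g p \<in> {1, 2, 3}"
    and const: "\<And>p q. p \<in> dual_pts \<Longrightarrow> q \<in> dual_pts \<Longrightarrow> p \<subseteq> q \<Longrightarrow> \<not> x \<subseteq> q \<Longrightarrow> g p = g q"
    and below: "{1, 2, 3} \<subseteq> g ` {p \<in> dual_pts. p \<subset> x}"
  shows "maps_onto TYPE('a) F3 leF3"
proof (rule maps_ontoI)
  define f where "f = (\<lambda>p. if x \<subseteq> p then 0 else g p)"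
  show "finitely_determined f"
    unfolding f_def by (intro finitely_determined_if finitely_determined_const x g)
  have f_eq_0: "f p = 0 \<longleftrightarrow> x \<subseteq> p" and f_range: "f p \<in> F3" for p
    using g(2)[of p] unfolding f_def F3_def by auto
  have attained: "\<exists>q\<in>dual_pts. q \<subseteq> p \<and> f q = k" if "p \<in> dual_pts" "x \<subseteq> p" "k \<in> F3" for p k
  proof (cases "k = 0")
    case True
    then show ?thesis using that f_eq_0 by blast
  next
    case False
    then have "k \<in> g ` {p \<in> dual_pts. p \<subset> x}" using below that(3) unfolding F3_def by blast
    then obtain q where "q \<in> dual_pts" "q \<subset> x" "g q = k" by blast
    then show ?thesis using that(2) unfolding f_def by (intro bexI[of _ q]) auto
  qed
  show "f ` dual_pts = F3"
    using f_range attained[OF r_pt le_r[OF x(1)]] by blast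
  show "bi_p_morphism f dual_pts (\<subseteq>) F3 leF3"
    unfolding bi_p_morphism_def
  proof (intro conjI ballI impI)
    show "f ` dual_pts \<subseteq> F3" using f_range by blast
    show "leF3 (f p) (f q)" if "p \<in> dual_pts" "q \<in> dual_pts" "p \<subseteq> q" for p q
      using const[OF that] that(3) unfolding f_def leF3_def by auto
    show "\<exists>q\<in>dual_pts. p \<subseteq> q \<and> f q = k" if "p \<in> dual_pts" "k \<in> F3" "leF3 (f p) k" for p k
      using that le_r[OF that(1)] le_r[OF x(1)] r_pt f_eq_0[of r] unfolding leF3_def by blast
    show "\<exists>q\<in>dual_pts. q \<subseteq> p \<and> f q = k" if "p \<in> dual_pts" "k \<in> F3" "leF3 k (f p)" for p k
      using that attained f_eq_0[of p] unfolding leF3_def by blast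
  qed
qed

lemma minimal_separation:
  assumes "s \<in> minimals" "t \<in> minimals" "s \<noteq> t"
  obtains a where "a \<in> s" "a \<notin> t"
  using assms minimal_eq[of t s] minimal_pt by blast

text \<open>Such a \<open>\<phi>\<close> is a clopen union of components of the points not above \<open>x\<close>. For \<open>z \<noteq> m\<close> the
  downset of \<open>z\<close> is one, but \<open>{m}\<close> need not be clopen.\<close>

lemma successor_component:
  assumes zx: "imm_pred z x" and z: "z \<in> up_set m"
    and y: "y1 \<in> minimals" "y2 \<in> minimals" "\<not> y1 \<subseteq> z" "\<not> y2 \<subseteq> z"
  obtains \<phi> where "finitely_determined \<phi>" "\<phi> z" "\<not> \<phi> y1" "\<not> \<phi> y2"
    and "\<And>p q. p \<in> dual_pts \<Longrightarrow> q \<in> dual_pts \<Longrightarrow> p \<subseteq> q \<Longrightarrow> \<not> x \<subseteq> q \<Longrightarrow> p = q \<or> \<phi> p \<and> \<phi> q"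
proof (cases "z = m")
  case True
  obtain a1 where a1: "a1 \<in> m" "a1 \<notin> y1"
    using minimal_separation[OF m_min y(1)] y(3) True by blast
  obtain a2 where a2: "a2 \<in> m" "a2 \<notin> y2"
    using minimal_separation[OF m_min y(2)] y(4) True by blast
  show thesis
  proof (rule that)
    show "finitely_determined (\<lambda>p. inf a1 a2 \<in> p)" by (rule finitely_determined_mem)
    show "inf a1 a2 \<in> z" "inf a1 a2 \<notin> y1" "inf a1 a2 \<notin> y2"
      using a1 a2 True m_pt y(1,2)[THEN minimal_pt] by (simp_all add: dual_pts_inf_iff)
    show "p = q \<or> inf a1 a2 \<in> p \<and> inf a1 a2 \<in> q"
      if "p \<in> dual_pts" "q \<in> dual_pts" "p \<subseteq> q" "\<not> x \<subseteq> q" for p q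
    proof -
      have "q \<in> minimals"
        using spine_or_minimal[OF that(2)] spine_successor_cases[OF zx z, of q] m_less_spine[of q]
          that(4) True by blast
      then show ?thesis using minimal_eq[OF _ that(1,3)] by simp
    qed
  qed
next
  case False
  then have z_spine: "z \<in> spine" using z up_set_eq by blast
  show thesis
  proof (rule that)
    show "finitely_determined (\<lambda>p. p \<subseteq> z)"
      using finitely_determined_spine_downset[OF zx z_spine] .
    show "z \<subseteq> z" "\<not> y1 \<subseteq> z" "\<not> y2 \<subseteq> z" using y(3,4) by auto
    show "p = q \<or> p \<subseteq> z \<and> q \<subseteq> z" if "p \<in> dual_pts" "q \<in> dual_pts" "p \<subseteq> q" "\<not> x \<subseteq> q" for p q
      using spine_or_minimal[OF that(2)] spine_successor_cases[OF zx z, of q]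
        minimal_eq[OF _ that(1,3)] that(3,4) by blast
  qed
qed

lemma successor_other_imm_pred:
  assumes zx: "imm_pred z x" and z: "z \<in> up_set m" and y: "imm_pred y x" "\<not> m \<subseteq> y"
  shows "y \<in> minimals" "\<not> y \<subseteq> z"
proof -
  show "y \<in> minimals"
    using above_m_or_minimal[OF imm_pred_pts(1)[OF y(1)]] y(2) by blast
  have "y \<noteq> z" using y(2) z unfolding up_set_def by blast
  then show "\<not> y \<subseteq> z"
    using imm_pred_no_between[OF y(1) imm_pred_pts(1)[OF zx]] imm_pred_less[OF zx] by blast
qed

lemma successor_tooth_unique:
  assumes F3: "\<not> maps_onto TYPE('a) F3 leF3"
    and zx: "imm_pred z x" and z: "z \<in> up_set m"
    and y: "imm_pred y1 x" "\<not> m \<subseteq> y1" "imm_pred y2 x" "\<not> m \<subseteq> y2"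
  shows "y1 = y2"
proof (rule ccontr)
  assume "y1 \<noteq> y2"
  note y1 = successor_other_imm_pred[OF zx z y(1,2)]
    and y2 = successor_other_imm_pred[OF zx z y(3,4)]
  obtain \<phi> where \<phi>: "finitely_determined \<phi>" "\<phi> z" "\<not> \<phi> y1" "\<not> \<phi> y2"
    and component: "\<And>p q. p \<in> dual_pts \<Longrightarrow> q \<in> dual_pts \<Longrightarrow> p \<subseteq> q \<Longrightarrow> \<not> x \<subseteq> q \<Longrightarrow>
      p = q \<or> \<phi> p \<and> \<phi> q"
    using successor_component[OF zx z y1(1) y2(1) y1(2) y2(2)] by metis
  obtain b where b: "b \<in> y1" "b \<notin> y2"
    using minimal_separation[OF y1(1) y2(1) \<open>y1 \<noteq> y2\<close>] .
  define g :: "'a set \<Rightarrow> nat" where "g = (\<lambda>p. if \<phi> p then 1 else if b \<in> p then 2 else 3)"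
  have "maps_onto TYPE('a) F3 leF3"
  proof (rule maps_onto_F3I)
    show "x \<in> dual_pts" using imm_pred_pts(2)[OF zx] .
    show "finitely_determined (\<lambda>p. x \<subseteq> p)" using finitely_determined_successor_upset[OF zx z] .
    show "finitely_determined g"
      unfolding g_def
      by (intro finitely_determined_if finitely_determined_mem finitely_determined_const \<phi>(1))
    show "g p \<in> {1, 2, 3}" for p unfolding g_def by simp
    show "g p = g q" if "p \<in> dual_pts" "q \<in> dual_pts" "p \<subseteq> q" "\<not> x \<subseteq> q" for p q
      using component[OF that] unfolding g_def by auto
    have "g z = 1" "g y1 = 2" "g y2 = 3" using \<phi> b unfolding g_def by simp_all
    then show "{1, 2, 3} \<subseteq> g ` {p \<in> dual_pts. p \<subset> x}"
      using imm_predD(1,3)[OF zx] imm_predD(1,3)[OF y(1)] imm_predD(1,3)[OF y(3)] by force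
  qed
  then show False using F3 by blast
qed

text \<open>Suppose no minimal point hangs exactly at the successor \<open>x\<close> of \<open>z\<close>. Collapsing the spine from
  \<open>x\<close> up to the next minimal point, and the points below \<open>z\<close> to a two-chain, yields the four-chain
  of \<open>F2\<close> with the minimal points not below \<open>x\<close> hanging at the top, or a three-chain if there are
  none.\<close>

definition gap_label :: "'a set \<Rightarrow> 'a set \<Rightarrow> 'a \<Rightarrow> 'a set \<Rightarrow> nat" where
  "gap_label z x v p =
     (if x \<subseteq> p then if \<exists>t\<in>minimals. t \<subseteq> p \<and> \<not> t \<subseteq> x then 0 else 1
      else if p \<subseteq> z then if v \<in> p then 2 else 3
      else 4)"

context
  fixes z x :: "'a set" and v :: 'a
  assumes zx: "imm_pred z x" and z: "z \<in> spine"
    and v: "v \<in> z" "\<And>y. y \<in> minimals \<Longrightarrow> v \<notin> y"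
    and gap: "\<And>p. p \<in> dual_pts \<Longrightarrow> p \<subset> x \<Longrightarrow> p \<subseteq> z"
begin

lemma x_spine: "x \<in> spine"
  using spine_upward[OF z imm_pred_pts(2)[OF zx]] imm_pred_less[OF zx] by blast

lemma gap_cases:
  assumes "p \<in> dual_pts"
  obtains (above) "x \<subseteq> p" | (below) "\<not> x \<subseteq> p" "p \<subseteq> z"
    | (aside) "\<not> x \<subseteq> p" "\<not> p \<subseteq> z" "p \<in> minimals" "\<not> p \<subseteq> x"
  using assms spine_or_minimal[OF assms] spine_successor_cases[OF zx, of p] z up_set_eq
    gap[OF assms] by blast

lemma gap_label_minimal_aside:
  assumes "t \<in> minimals" "\<not> t \<subseteq> x"
  shows "gap_label z x v t = 4"
  using assms minimal_eq[OF assms(1) spine_pt[OF x_spine]] imm_pred_less[OF zx]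
  unfolding gap_label_def by auto

lemma gap_label_chain: "gap_label z x v x = 1" "gap_label z x v z = 2" "gap_label z x v m = 3"
  using v m_min m_less_spine[OF z] imm_pred_less[OF zx] unfolding gap_label_def by auto

lemma gap_label_top:
  assumes "t \<in> minimals" "\<not> t \<subseteq> x"
  shows "gap_label z x v r = 0"
  using assms le_r[OF minimal_pt[OF assms(1)]] le_r[OF spine_pt[OF x_spine]]
  unfolding gap_label_def by auto

lemma finitely_determined_minimal_aside:
  "finitely_determined (\<lambda>p. \<exists>t\<in>minimals. t \<subseteq> p \<and> \<not> t \<subseteq> x)"
proof -
  have "z \<in> up_set m" using z up_set_eq by simp
  then obtain u where u: "\<And>q. q \<in> dual_pts \<Longrightarrow> u \<in> q \<longleftrightarrow> x \<subseteq> q"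
    using successor_upset_witness[OF zx] by metis
  have aside_iff: "imp v u \<in> t \<and> u \<notin> t \<longleftrightarrow> t \<in> minimals \<and> \<not> t \<subseteq> x" if t: "t \<in> dual_pts" for t
    using t
  proof (cases rule: gap_cases)
    case above
    then show ?thesis using u[OF t] minimal_eq[OF _ spine_pt[OF x_spine]] by blast
  next
    case below
    then show ?thesis using spine_downset_witness[OF zx z u v t] imm_pred_less[OF zx] by blast
  next
    case aside
    then show ?thesis using spine_downset_witness[OF zx z u v t] u[OF t] by blast
  qed
  have "coimp (imp v u) u \<in> p \<longleftrightarrow> (\<exists>t\<in>minimals. t \<subseteq> p \<and> \<not> t \<subseteq> x)" if "p \<in> dual_pts" for p
    unfolding coimp_mem_iff[OF that] by (metis aside_iff minimal_pt)
  then show ?thesis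
    using finitely_determined_mem by (rule finitely_determined_cong)
qed

lemma finitely_determined_gap_label: "finitely_determined (gap_label z x v)"
proof -
  have "z \<in> up_set m" using z up_set_eq by simp
  then show ?thesis
    unfolding gap_label_def
    by (intro finitely_determined_if finitely_determined_const finitely_determined_mem
        finitely_determined_successor_upset[OF zx] finitely_determined_spine_downset[OF zx z]
        finitely_determined_minimal_aside)
qed

lemma gap_label_mono:
  assumes pq: "p \<in> dual_pts" "q \<in> dual_pts" "p \<subseteq> q"
  shows "leF2 (gap_label z x v p) (gap_label z x v q)"
  using pq(2)
proof (cases rule: gap_cases)
  case above
  have inherited: "\<exists>t\<in>minimals. t \<subseteq> q \<and> \<not> t \<subseteq> x" if "\<exists>t\<in>minimals. t \<subseteq> p \<and> \<not> t \<subseteq> x"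
    using that pq(3) by blast
  show ?thesis
    using pq(1)
  proof (cases rule: gap_cases)
    case aside
    then have "gap_label z x v q = 0" using \<open>x \<subseteq> q\<close> pq(3) unfolding gap_label_def by auto
    then show ?thesis
      using gap_label_minimal_aside[OF aside(3,4)] unfolding leF2_def by simp
  qed (use \<open>x \<subseteq> q\<close> inherited in \<open>simp_all add: gap_label_def leF2_def\<close>)
next
  case below
  then show ?thesis using pq(3) unfolding gap_label_def leF2_def by auto
next
  case aside
  then show ?thesis using minimal_eq[OF _ pq(1,3)] unfolding leF2_def by simp
qed

lemma gap_label_image:
  "gap_label z x v ` dual_pts = (if \<exists>t\<in>minimals. \<not> t \<subseteq> x then F2 else {1, 2, 3})"
proof -
  let ?f = "gap_label z x v"
  have chain: "{1, 2, 3} \<subseteq> ?f ` dual_pts"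
    using gap_label_chain spine_pt[OF x_spine] spine_pt[OF z] m_pt by force
  show ?thesis
  proof (cases "\<exists>t\<in>minimals. \<not> t \<subseteq> x")
    case True
    then obtain t where t: "t \<in> minimals" "\<not> t \<subseteq> x" by blast
    have "{0, 4} \<subseteq> ?f ` dual_pts"
      using gap_label_top[OF t] gap_label_minimal_aside[OF t] r_pt minimal_pt[OF t(1)] by force
    moreover have "?f ` dual_pts \<subseteq> F2" unfolding gap_label_def F2_def by auto
    moreover have "F2 = {0, 4} \<union> {1, 2, 3}" unfolding F2_def by auto
    ultimately have "?f ` dual_pts = F2" using chain by (metis Un_least subset_antisym)
    then show ?thesis using True by simp
  next
    case False
    have "?f p \<in> {1, 2, 3}" if "p \<in> dual_pts" for p
      using that False by (cases rule: gap_cases) (auto simp: gap_label_def)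
    then show ?thesis using False chain by auto
  qed
qed

lemma gap_label_up:
  assumes p: "p \<in> dual_pts" and k: "k \<in> gap_label z x v ` dual_pts" "leF2 (gap_label z x v p) k"
  shows "\<exists>q\<in>dual_pts. p \<subseteq> q \<and> gap_label z x v q = k"
proof -
  have "k \<in> F2" using k(1) gap_label_image unfolding F2_def by (auto split: if_splits)
  then consider (same) "k = gap_label z x v p" | (top) "k = 0" | (upper) "k = 1" "p \<subseteq> z"
    | (lower) "k = 2" "p \<subseteq> z"
    using k(2) unfolding F2_def leF2_def gap_label_def by (auto split: if_splits)
  then show ?thesis
  proof cases
    case same
    then show ?thesis using p by blast
  next
    case top
    then obtain t where "t \<in> minimals" "\<not> t \<subseteq> x"
      using k(1) gap_label_image by (auto split: if_splits)
    then have "gap_label z x v r = 0" by (rule gap_label_top)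
    then show ?thesis using top r_pt le_r[OF p] by blast
  next
    case upper
    then show ?thesis
      using gap_label_chain(1) spine_pt[OF x_spine] imm_pred_less[OF zx] by blast
  next
    case lower
    then show ?thesis using gap_label_chain(2) spine_pt[OF z] by blast
  qed
qed

lemma gap_label_down:
  assumes p: "p \<in> dual_pts" and k: "k \<in> gap_label z x v ` dual_pts" "leF2 k (gap_label z x v p)"
  shows "\<exists>q\<in>dual_pts. q \<subseteq> p \<and> gap_label z x v q = k"
proof -
  have "k \<in> F2" using k(1) gap_label_image unfolding F2_def by (auto split: if_splits)
  then consider (same) "k = gap_label z x v p" | (upper) "k = 1" "x \<subseteq> p" | (lower) "k = 2" "x \<subseteq> p"
    | (bottom) "k = 3" "x \<subseteq> p \<or> v \<in> p" | (aside) "k = 4" "\<exists>t\<in>minimals. t \<subseteq> p \<and> \<not> t \<subseteq> x"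
    using k(2) unfolding F2_def leF2_def gap_label_def by (auto split: if_splits)
  then show ?thesis
  proof cases
    case same
    then show ?thesis using p by blast
  next
    case upper
    then show ?thesis using gap_label_chain(1) spine_pt[OF x_spine] by blast
  next
    case lower
    then show ?thesis using gap_label_chain(2) spine_pt[OF z] imm_pred_less[OF zx] by blast
  next
    case bottom
    then have "p \<in> spine"
      using spine_upward[OF x_spine p] spine_or_minimal[OF p] v(2) by blast
    then show ?thesis using bottom gap_label_chain(3) m_pt m_less_spine by blast
  next
    case aside
    then show ?thesis using gap_label_minimal_aside minimal_pt by blast
  qed
qed

lemma bi_p_morphism_gap_label:
  "bi_p_morphism (gap_label z x v) dual_pts (\<subseteq>) (gap_label z x v ` dual_pts) leF2"
  unfolding bi_p_morphism_def
  using gap_label_mono gap_label_up gap_label_down by simp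

lemma gap_maps_onto: "maps_onto TYPE('a) F1 leF1 \<or> maps_onto TYPE('a) F2 leF2"
proof (cases "\<exists>t\<in>minimals. \<not> t \<subseteq> x")
  case True
  then have "gap_label z x v ` dual_pts = F2" using gap_label_image by simp
  then show ?thesis
    using maps_ontoI[OF finitely_determined_gap_label] bi_p_morphism_gap_label by metis
next
  case False
  then have image: "gap_label z x v ` dual_pts = {1, 2, 3}" using gap_label_image by simp
  have "bi_p_morphism (\<lambda>k. k - 1) {1, 2, 3} leF2 F1 leF1"
    unfolding bi_p_morphism_def leF2_def leF1_def F1_def by auto
  then have "bi_p_morphism (\<lambda>p. gap_label z x v p - 1) dual_pts (\<subseteq>) F1 leF1"
    using bi_p_morphism_comp bi_p_morphism_gap_label unfolding image by blast
  moreover have "(\<lambda>p. gap_label z x v p - 1) ` dual_pts = F1"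
  proof -
    have "(\<lambda>p. gap_label z x v p - 1) ` dual_pts = (\<lambda>k. k - 1) ` {1, 2, 3}"
      unfolding image[symmetric] image_image ..
    then show ?thesis unfolding F1_def by simp
  qed
  ultimately show ?thesis
    using maps_ontoI finitely_determined_compose[OF finitely_determined_gap_label, of "\<lambda>k. k - 1"]
    by blast
qed

end

lemma successor_tooth_exists:
  assumes F1: "\<not> maps_onto TYPE('a) F1 leF1" and F2: "\<not> maps_onto TYPE('a) F2 leF2"
    and zx: "imm_pred z x" and z: "z \<in> spine"
  shows "\<exists>t\<in>teeth x x. \<not> t \<subseteq> z"
proof (rule ccontr)
  assume none: "\<not> ?thesis"
  have z_up: "z \<in> up_set m" using z up_set_eq by simp
  have gap: "p \<subseteq> z" if p: "p \<in> dual_pts" "p \<subset> x" for p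
  proof (rule ccontr)
    assume np: "\<not> p \<subseteq> z"
    have cases: "x \<subseteq> q" if "q \<in> spine" "p \<subseteq> q" for q
      using spine_successor_cases[OF zx z_up that(1)] that(2) np by blast
    then have "p \<in> minimals" using spine_or_minimal[OF p(1)] p(2) by blast
    then have "p \<in> teeth x x" using cases p(2) unfolding teeth_def by blast
    then show False using none np by blast
  qed
  obtain v where v: "v \<in> z" "\<And>y. y \<in> minimals \<Longrightarrow> v \<notin> y"
    using nonminimal_witness[OF spine_pt[OF z] spine_not_minimal[OF z]] by blast
  show False using gap_maps_onto[OF zx z v gap] F1 F2 by blast
qed

end

section \<open>Limits in finitely generated combs\<close>

lemma
  assumes "finite H" "\<C> \<noteq> {}" "subset.chain \<A> \<C>"
  shows trace_of_Union_chain: "\<exists>c\<in>\<C>. c \<inter> H = \<Union>\<C> \<inter> H"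
    and trace_of_Inter_chain: "\<exists>c\<in>\<C>. c \<inter> H = \<Inter>\<C> \<inter> H"
proof -
  let ?traces = "(\<lambda>c. c \<inter> H) ` \<C>"
  have "finite ?traces"
    by (rule finite_subset[of _ "Pow H"]) (use assms(1) in auto)
  moreover have "?traces \<noteq> {}" using assms(2) by simp
  moreover have "subset.chain UNIV ?traces"
    using assms(3) unfolding subset_chain_def by (auto 0 3)
  ultimately have "\<Union>?traces \<in> ?traces" "\<Inter>?traces \<in> ?traces"
    using Union_in_chain Inter_in_chain by blast+
  moreover have "\<Union>?traces = \<Union>\<C> \<inter> H" "\<Inter>?traces = \<Inter>\<C> \<inter> H"
    using assms(2) by auto
  ultimately show "\<exists>c\<in>\<C>. c \<inter> H = \<Union>\<C> \<inter> H" "\<exists>c\<in>\<C>. c \<inter> H = \<Inter>\<C> \<inter> H"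
    by (metis imageE)+
qed

locale LFC_comb = comb imp coimp m r
  for imp coimp :: "'a::{distrib_lattice,bounded_lattice} \<Rightarrow> 'a \<Rightarrow> 'a" and m r +
  fixes G :: "'a set"
  assumes finite_generators: "finite G" and generators: "bh_generated imp coimp G = UNIV"
    and no_F1: "\<not> maps_onto TYPE('a) F1 leF1"
    and no_F2: "\<not> maps_onto TYPE('a) F2 leF2"
    and no_F3: "\<not> maps_onto TYPE('a) F3 leF3"
    and hanging: "t \<in> minimals \<Longrightarrow> t \<noteq> m \<Longrightarrow> \<exists>z. imm_pred t z \<and> m \<subset> z"
begin

abbreviation colour :: "'a set \<Rightarrow> 'a set" where
  "colour p \<equiv> p \<inter> G"

lemma downset_collapse:
  assumes w: "w \<in> dual_pts" and colour: "\<And>t. t \<in> dual_pts \<Longrightarrow> t \<subseteq> w \<Longrightarrow> colour t = colour w"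
    and p: "p \<in> dual_pts" "p \<subseteq> w"
  shows "p = w"
proof -
  define D where "D = {t \<in> dual_pts. t \<subseteq> w}"
  have "bisimulation G (\<lambda>c d. c \<in> D \<and> d \<in> D)" (is "bisimulation G ?R")
  proof (rule bisimulationI)
    show "\<exists>v\<in>dual_pts. y \<subseteq> v \<and> ?R\<^sup>=\<^sup>= u v" if R: "?R x y" and u: "u \<in> dual_pts" "x \<subseteq> u" for x y u
    proof (cases "u \<subseteq> w")
      case True
      then show ?thesis using R u(1) w unfolding D_def by (intro bexI[of _ w]) auto
    next
      case False
      then have "w \<subseteq> u" using upper_chain[OF biLC _ u w] R unfolding D_def by blast
      then show ?thesis using R u(1) unfolding D_def by (intro bexI[of _ u]) auto
    qed
    show "\<exists>v\<in>dual_pts. v \<subseteq> y \<and> ?R\<^sup>=\<^sup>= u v" if "?R x y" "u \<in> dual_pts" "u \<subseteq> x" for x y u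
      using that unfolding D_def by (intro bexI[of _ y]) auto
  qed (use colour in \<open>auto simp: D_def\<close>)
  then show ?thesis
    by (rule bisimulation_imp_eq[OF generators]) (use p w in \<open>auto simp: D_def\<close>)
qed

definition spine_segment :: "'a set \<Rightarrow> 'a set \<Rightarrow> 'a set set" where
  "spine_segment a b = {c \<in> dual_pts. a \<subseteq> c \<and> c \<subseteq> b}"

definition segment_rel :: "'a set \<Rightarrow> 'a set \<Rightarrow> 'a set \<Rightarrow> 'a set \<Rightarrow> bool" where
  "segment_rel a b c d \<longleftrightarrow>
     c \<in> spine_segment a b \<and> d \<in> spine_segment a b \<or>
     c \<in> teeth a b \<and> d \<in> teeth a b \<and> colour c = colour d"

lemma segment_rel_below: "segment_rel a b c d \<Longrightarrow> d \<in> dual_pts \<and> d \<subseteq> b"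
  using teethD(2,3) unfolding segment_rel_def spine_segment_def by blast

lemma segment_rel_up:
  assumes ab: "a \<in> spine" "b \<in> spine" "a \<subseteq> b"
    and R: "segment_rel a b x y" and u: "u \<in> dual_pts" "x \<subseteq> u"
  shows "\<exists>v\<in>dual_pts. y \<subseteq> v \<and> (segment_rel a b)\<^sup>=\<^sup>= u v"
proof (cases "a \<subseteq> u")
  case True
  then consider (inside) "u \<subseteq> b" | (beyond) "b \<subseteq> u"
    using spine_linear[OF spine_upward[OF ab(1) u(1) True] ab(2)] by blast
  then show ?thesis
  proof cases
    case inside
    then have "segment_rel a b u b"
      using True u(1) ab(3) spine_pt[OF ab(2)] unfolding segment_rel_def spine_segment_def by simp
    then show ?thesis using segment_rel_below[OF R] spine_pt[OF ab(2)] by auto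
  next
    case beyond
    then show ?thesis using segment_rel_below[OF R] u(1) by (intro bexI[of _ u]) auto
  qed
next
  case False
  then have x: "x \<in> teeth a b" using R u(2) unfolding segment_rel_def spine_segment_def by blast
  then have "u = x"
    using teethD(4)[OF x above_minimal_spine[OF teethD(1)[OF x] u(1)]] u(2) False by blast
  then show ?thesis using R segment_rel_below[OF R] by auto
qed

lemma segment_rel_down:
  assumes ab: "a \<in> spine" "a \<subseteq> b" and teeth_colours: "colour ` teeth a b \<subseteq> colour ` teeth a a"
    and R: "segment_rel a b x y" and u: "u \<in> dual_pts" "u \<subseteq> x"
  shows "\<exists>v\<in>dual_pts. v \<subseteq> y \<and> (segment_rel a b)\<^sup>=\<^sup>= u v"
proof (cases "x \<in> teeth a b")
  case True
  then have "u = x" using minimal_eq[OF teethD(1) u] by blast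
  then show ?thesis using R segment_rel_below[OF R] by auto
next
  case False
  then have segment: "x \<in> spine_segment a b" "y \<in> spine_segment a b"
    using R unfolding segment_rel_def by blast+
  consider (below) "u \<subseteq> a" | (inside) "u \<in> spine" "a \<subseteq> u" | (tooth) "u \<in> teeth a b"
    using spine_or_minimal[OF u(1)] spine_linear[OF ab(1), of u] teeth_segment_iff[OF ab(1), of u b]
      u(2) segment(1) unfolding spine_segment_def by blast
  then show ?thesis
  proof cases
    case below
    then show ?thesis
      using u(1) segment(2) unfolding spine_segment_def by (intro bexI[of _ u]) auto
  next
    case inside
    then have "u \<in> spine_segment a b" using u segment(1) unfolding spine_segment_def by blast
    then show ?thesis
      using segment(2) segment_rel_below[OF R] unfolding segment_rel_def
      by (intro bexI[of _ y]) auto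
  next
    case tooth
    then have "colour u \<in> colour ` teeth a a" using teeth_colours by blast
    then obtain p where p: "p \<in> teeth a a" "colour u = colour p" by (rule imageE)
    then have "p \<in> teeth a b" "p \<subseteq> y" "p \<in> dual_pts"
      using ab(2) segment(2) teethD(2)[OF p(1)] unfolding teeth_def spine_segment_def by blast+
    then show ?thesis using tooth p(2) unfolding segment_rel_def by auto
  qed
qed

lemma bisimulation_segment_rel:
  assumes ab: "a \<in> spine" "b \<in> spine" "a \<subseteq> b" and colour: "colour a = colour b"
    and teeth_colours: "colour ` teeth a b \<subseteq> colour ` teeth a a"
  shows "bisimulation G (segment_rel a b)"
proof (rule bisimulationI)
  show sym: "segment_rel a b y x" if "segment_rel a b x y" for x y
    using that unfolding segment_rel_def by auto
  show "x \<in> dual_pts" if "segment_rel a b x y" for x y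
    using segment_rel_below[OF sym[OF that]] by blast
  have "colour c = colour a" if "c \<in> spine_segment a b" for c
    using that colour unfolding spine_segment_def by blast
  then show "colour x = colour y" if "segment_rel a b x y" for x y
    using that unfolding segment_rel_def by metis
qed (fact segment_rel_up[OF ab] segment_rel_down[OF ab(1,3) teeth_colours])+

lemma segment_collapse:
  assumes "a \<in> spine" "b \<in> spine" "a \<subseteq> b" "colour a = colour b"
    "colour ` teeth a b \<subseteq> colour ` teeth a a"
  shows "a = b" and "inj_on colour (teeth a b)"
proof -
  note collapse = bisimulation_imp_eq[OF generators bisimulation_segment_rel[OF assms]]
  show "a = b"
    by (rule collapse) (use assms(1-3) spine_pt in \<open>auto simp: segment_rel_def spine_segment_def\<close>)
  show "inj_on colour (teeth a b)"
    by (intro inj_onI) (rule collapse, simp add: segment_rel_def)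
qed

lemma finite_teeth:
  assumes "x \<in> spine"
  shows "finite (teeth x x)" "card (teeth x x) \<le> 2 ^ card G"
proof -
  have inj: "inj_on colour (teeth x x)" using segment_collapse(2)[OF assms assms] by simp
  have sub: "colour ` teeth x x \<subseteq> Pow G" by blast
  show "finite (teeth x x)"
    using inj_on_finite[OF inj sub] finite_generators by simp
  show "card (teeth x x) \<le> 2 ^ card G"
    using card_inj_on_le[OF inj sub] finite_generators by (simp add: card_Pow)
qed

definition strictly_above :: "'a set \<Rightarrow> 'a set set" where
  "strictly_above x = {c \<in> dual_pts. x \<subset> c}"

definition spine_below :: "'a set \<Rightarrow> 'a set set" where
  "spine_below x = {c \<in> spine. c \<subset> x}"

lemma strictly_above_subset_spine: "x \<in> up_set m \<Longrightarrow> strictly_above x \<subseteq> spine"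
  unfolding strictly_above_def up_set_def spine_def by blast

lemma strictly_above_Int:
  assumes "x \<in> up_set m" "c \<in> strictly_above x" "d \<in> strictly_above x"
  shows "c \<inter> d \<in> strictly_above x"
proof -
  have "c \<subseteq> d \<or> d \<subseteq> c"
    using spine_linear strictly_above_subset_spine[OF assms(1)] assms(2,3) by blast
  then show ?thesis using assms(2,3) by (metis inf.absorb1 inf.absorb2)
qed

lemma spine_below_Un:
  assumes "c \<in> spine_below x" "d \<in> spine_below x"
  shows "c \<union> d \<in> spine_below x"
proof -
  have "c \<subseteq> d \<or> d \<subseteq> c"
    using spine_linear assms unfolding spine_below_def by blast
  then show ?thesis using assms by (metis sup.absorb1 sup.absorb2)
qed

lemma down_limit_Inter:
  assumes "down_limit m r x"
  shows "\<Inter>(strictly_above x) = x" "strictly_above x \<noteq> {}"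
proof -
  have x: "x \<in> up_set m" "x \<in> dual_pts" "x \<noteq> r" and no: "\<not> imm_pred x y" for y
    using assms unfolding down_limit_def up_set_def by auto
  have "r \<in> strictly_above x" using x(2,3) le_r r_pt unfolding strictly_above_def by blast
  then show ne: "strictly_above x \<noteq> {}" by blast
  have "\<Inter>(strictly_above x) \<in> dual_pts"
    using dual_pts_Inter_chain[OF ne subset_chain_spine[OF strictly_above_subset_spine[OF x(1)]]] .
  moreover have "\<not> w \<subset> \<Inter>(strictly_above x)" if "w \<in> dual_pts" "x \<subset> w" for w
    using that unfolding strictly_above_def by blast
  ultimately have "\<not> x \<subset> \<Inter>(strictly_above x)"
    using no[of "\<Inter>(strictly_above x)"] x(2) unfolding imm_pred_def by blast
  then show "\<Inter>(strictly_above x) = x" unfolding strictly_above_def by blast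
qed

lemma up_limitD:
  assumes "up_limit m x"
  shows "x \<in> spine" and "z \<in> up_set m \<Longrightarrow> \<not> imm_pred z x"
  using assms unfolding up_limit_def spine_def by auto

lemma up_limit_Union:
  assumes "up_limit m x"
  shows "\<Union>(spine_below x) = x" "spine_below x \<noteq> {}"
proof -
  note x = up_limitD(1)[OF assms] and no = up_limitD(2)[OF assms]
  have "\<not> imm_pred m x" using no up_set_eq by blast
  then show ne: "spine_below x \<noteq> {}"
    using m_pt spine_pt[OF x] m_less_spine[OF x] unfolding imm_pred_def spine_below_def spine_def
    by blast
  have "spine_below x \<subseteq> spine" unfolding spine_below_def by blast
  then have U: "\<Union>(spine_below x) \<in> dual_pts"
    using dual_pts_Union_chain[OF ne subset_chain_spine] by blast
  then have U_spine: "\<Union>(spine_below x) \<in> spine"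
    using ne spine_upward unfolding spine_below_def by blast
  have "\<not> w \<subset> x" if "w \<in> dual_pts" "\<Union>(spine_below x) \<subset> w" for w
    using spine_upward[OF U_spine that(1)] that(2) unfolding spine_below_def by blast
  then have "\<not> \<Union>(spine_below x) \<subset> x"
    using no[of "\<Union>(spine_below x)"] U U_spine spine_pt[OF x] up_set_eq
    unfolding imm_pred_def by blast
  then show "\<Union>(spine_below x) = x" unfolding spine_below_def by blast
qed

lemma not_down_limit_m: "\<not> down_limit m r m"
proof
  assume limit: "down_limit m r m"
  note Q = down_limit_Inter[OF limit]
  have m: "m \<in> up_set m" using up_set_eq by simp
  have "\<exists>w\<in>strictly_above m. colour ` {t \<in> dual_pts. t \<subseteq> w} \<subseteq> colour ` {m}"
  proof (rule directed_traces_of_cluster_points[OF finite_generators Q(2)])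
    show "\<exists>k\<in>strictly_above m.
        {t \<in> dual_pts. t \<subseteq> k} \<subseteq> {t \<in> dual_pts. t \<subseteq> i} \<inter> {t \<in> dual_pts. t \<subseteq> j}"
      if "i \<in> strictly_above m" "j \<in> strictly_above m" for i j
      by (rule bexI[OF _ strictly_above_Int[OF m that]]) blast
    show "P \<in> {m}"
      if cluster: "\<And>w. w \<in> strictly_above m \<Longrightarrow>
        P \<in> priestley_top closure_of {t \<in> dual_pts. t \<subseteq> w}" for P
    proof -
      have "P \<in> dual_pts \<and> P \<subseteq> w" if "w \<in> strictly_above m" for w
        using cluster[OF that]
          closure_of_minimal[OF subset_refl closedin_priestley_top_downset[of w]] by blast
      then have "P \<in> dual_pts" "P \<subseteq> \<Inter>(strictly_above m)" using Q(2) by blast+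
      then show ?thesis using minimal_eq[OF m_min] Q(1) by simp
    qed
  qed blast
  then obtain w where "w \<in> strictly_above m"
    and "colour ` {t \<in> dual_pts. t \<subseteq> w} \<subseteq> {colour m}" by auto
  then have w: "w \<in> spine" and mono: "t \<in> dual_pts \<Longrightarrow> t \<subseteq> w \<Longrightarrow> colour t = colour m" for t
    using strictly_above_subset_spine[OF m] by auto
  have "m = w"
  proof (rule downset_collapse[OF spine_pt[OF w] _ m_pt])
    show "colour t = colour w" if "t \<in> dual_pts" "t \<subseteq> w" for t
      using mono[OF that] mono[OF spine_pt[OF w] subset_refl] by simp
    show "m \<subseteq> w" using m_less_spine[OF w] by blast
  qed
  then show False using m_less_spine[OF w] by blast
qed

lemma down_limit_teeth_colours:
  assumes limit: "down_limit m r x" and x: "x \<in> spine"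
  shows "\<exists>w\<in>strictly_above x. colour ` {t \<in> minimals. t \<subseteq> w \<and> \<not> t \<subseteq> x} \<subseteq> colour ` teeth x x"
proof (rule directed_traces_of_cluster_points[OF finite_generators])
  note Q = down_limit_Inter[OF limit]
  let ?S = "\<lambda>w. {t \<in> minimals. t \<subseteq> w \<and> \<not> t \<subseteq> x}"
  have x_up: "x \<in> up_set m" using x up_set_eq by simp
  show "strictly_above x \<noteq> {}" by (rule Q(2))
  show "?S w \<subseteq> dual_pts" for w using minimal_pt by blast
  show "\<exists>k\<in>strictly_above x. ?S k \<subseteq> ?S i \<inter> ?S j"
    if "i \<in> strictly_above x" "j \<in> strictly_above x" for i j
    by (rule bexI[OF _ strictly_above_Int[OF x_up that]]) blast
  show "P \<in> teeth x x"
    if cluster: "\<And>w. w \<in> strictly_above x \<Longrightarrow> P \<in> priestley_top closure_of ?S w" for P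
  proof -
    have "P \<in> minimals" "P \<subseteq> w" if "w \<in> strictly_above x" for w
      using closure_of_minimals_below[OF cluster[OF that]] by auto
    then have "P \<in> minimals" "P \<subseteq> \<Inter>(strictly_above x)" using Q(2) by blast+
    moreover have "x \<subseteq> q" if q: "q \<in> spine" "P \<subseteq> q" for q
    proof -
      obtain w where "w \<in> strictly_above x" using Q(2) by blast
      then have "P \<in> priestley_top closure_of {t \<in> minimals. \<not> t \<subseteq> x}"
        using cluster closure_of_mono[of "?S w" "{t \<in> minimals. \<not> t \<subseteq> x}"] by blast
      then show ?thesis using closure_of_teeth_above[OF x q(1)] q(2) by blast
    qed
    ultimately show ?thesis unfolding teeth_def Q(1) by blast
  qed
qed

lemma up_limit_teeth_colours:
  assumes limit: "up_limit m x"
  shows "\<exists>c\<in>spine_below x. colour ` {t \<in> minimals. t \<subseteq> x \<and> \<not> t \<subseteq> c} \<subseteq> colour ` teeth x x"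
proof (rule directed_traces_of_cluster_points[OF finite_generators])
  note Q = up_limit_Union[OF limit]
  let ?S = "\<lambda>c. {t \<in> minimals. t \<subseteq> x \<and> \<not> t \<subseteq> c}"
  show "spine_below x \<noteq> {}" by (rule Q(2))
  show "?S c \<subseteq> dual_pts" for c using minimal_pt by blast
  show "\<exists>k\<in>spine_below x. ?S k \<subseteq> ?S i \<inter> ?S j" if "i \<in> spine_below x" "j \<in> spine_below x" for i j
    by (rule bexI[OF _ spine_below_Un[OF that]]) blast
  show "P \<in> teeth x x"
    if cluster: "\<And>c. c \<in> spine_below x \<Longrightarrow> P \<in> priestley_top closure_of ?S c" for P
  proof -
    obtain c where "c \<in> spine_below x" using Q(2) by blast
    then have "P \<in> minimals" "P \<subseteq> x"
      using closure_of_minimals_below[of P "?S c" x] cluster by blast+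
    moreover have "x \<subseteq> q" if q: "q \<in> spine" "P \<subseteq> q" for q
    proof -
      have "c \<subseteq> q" if c: "c \<in> spine_below x" for c
      proof -
        have "P \<in> priestley_top closure_of {t \<in> minimals. \<not> t \<subseteq> c}"
          using cluster[OF c] closure_of_mono[of "?S c" "{t \<in> minimals. \<not> t \<subseteq> c}"] by blast
        then show ?thesis
          using closure_of_teeth_above[OF _ q(1)] q(2) c unfolding spine_below_def by blast
      qed
      then show ?thesis using Q(1) by blast
    qed
    ultimately show ?thesis unfolding teeth_def by blast
  qed
qed

lemma down_limit_neighbourhood:
  assumes limit: "down_limit m r x" and x: "x \<in> spine"
  obtains w where "w \<in> spine" "x \<subset> w" "colour w = colour x"
    and "colour ` {t \<in> minimals. t \<subseteq> w \<and> \<not> t \<subseteq> x} \<subseteq> colour ` teeth x x"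
proof -
  have x_up: "x \<in> up_set m" using x up_set_eq by simp
  note Q = down_limit_Inter[OF limit] and sub = strictly_above_subset_spine[OF x_up]
  obtain w1 where w1: "w1 \<in> strictly_above x"
    "colour ` {t \<in> minimals. t \<subseteq> w1 \<and> \<not> t \<subseteq> x} \<subseteq> colour ` teeth x x"
    using down_limit_teeth_colours[OF limit x] by blast
  obtain w2 where w2: "w2 \<in> strictly_above x" "colour w2 = colour x"
    using trace_of_Inter_chain[OF finite_generators Q(2) subset_chain_spine[OF sub]] Q(1) by auto
  have w: "w1 \<inter> w2 \<in> strictly_above x"
    using strictly_above_Int[OF x_up w1(1) w2(1)] .
  show thesis
  proof (rule that)
    show "w1 \<inter> w2 \<in> spine" using w sub by blast
    show "x \<subset> w1 \<inter> w2" using w unfolding strictly_above_def by blast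
    then show "colour (w1 \<inter> w2) = colour x" using w2(2) by blast
    have "{t \<in> minimals. t \<subseteq> w1 \<inter> w2 \<and> \<not> t \<subseteq> x} \<subseteq> {t \<in> minimals. t \<subseteq> w1 \<and> \<not> t \<subseteq> x}" by blast
    then show "colour ` {t \<in> minimals. t \<subseteq> w1 \<inter> w2 \<and> \<not> t \<subseteq> x} \<subseteq> colour ` teeth x x"
      using w1(2) by (meson image_mono subset_trans)
  qed
qed

lemma up_limit_neighbourhood:
  assumes limit: "up_limit m x"
  obtains c where "c \<in> spine_below x" "colour c = colour x"
    and "colour ` {t \<in> minimals. t \<subseteq> x \<and> \<not> t \<subseteq> c} \<subseteq> colour ` teeth x x"
proof -
  note Q = up_limit_Union[OF limit]
  have sub: "spine_below x \<subseteq> spine" unfolding spine_below_def by blast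
  obtain c1 where c1: "c1 \<in> spine_below x"
    "colour ` {t \<in> minimals. t \<subseteq> x \<and> \<not> t \<subseteq> c1} \<subseteq> colour ` teeth x x"
    using up_limit_teeth_colours[OF limit] by blast
  obtain c2 where c2: "c2 \<in> spine_below x" "colour c2 = colour x"
    using trace_of_Union_chain[OF finite_generators Q(2) subset_chain_spine[OF sub]] Q(1) by auto
  show thesis
  proof (rule that)
    show c: "c1 \<union> c2 \<in> spine_below x" using spine_below_Un[OF c1(1) c2(1)] .
    show "colour (c1 \<union> c2) = colour x" using c c2(2) unfolding spine_below_def by blast
    have "{t \<in> minimals. t \<subseteq> x \<and> \<not> t \<subseteq> c1 \<union> c2} \<subseteq> {t \<in> minimals. t \<subseteq> x \<and> \<not> t \<subseteq> c1}" by blast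
    then show "colour ` {t \<in> minimals. t \<subseteq> x \<and> \<not> t \<subseteq> c1 \<union> c2} \<subseteq> colour ` teeth x x"
      using c1(2) by (meson image_mono subset_trans)
  qed
qed

theorem no_down_limit: "\<not> down_limit m r x"
proof
  assume limit: "down_limit m r x"
  then have "x \<in> up_set m" "x \<noteq> m" using not_down_limit_m unfolding down_limit_def by auto
  then have x: "x \<in> spine" using up_set_eq by simp
  obtain w where w: "w \<in> spine" "x \<subset> w" "colour w = colour x"
    and recurs: "colour ` {t \<in> minimals. t \<subseteq> w \<and> \<not> t \<subseteq> x} \<subseteq> colour ` teeth x x"
    using down_limit_neighbourhood[OF limit x] .
  have "x = w"
  proof (rule segment_collapse(1)[OF x w(1)])
    show "x \<subseteq> w" "colour x = colour w" using w(2,3) by auto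
    show "colour ` teeth x w \<subseteq> colour ` teeth x x"
    proof (rule image_subsetI)
      fix t assume "t \<in> teeth x w"
      then have "t \<in> teeth x x \<or> t \<in> {t \<in> minimals. t \<subseteq> w \<and> \<not> t \<subseteq> x}"
        unfolding teeth_def by blast
      then show "colour t \<in> colour ` teeth x x"
        using subsetD[OF recurs imageI] by (elim disjE) simp_all
    qed
  qed
  then show False using w(2) by blast
qed

lemma up_set_least:
  assumes Q: "Q \<subseteq> up_set m" "Q \<noteq> {}"
  shows "\<Inter>Q \<in> Q"
proof (rule ccontr)
  assume "\<Inter>Q \<notin> Q"
  then have less: "\<Inter>Q \<subset> q" if "q \<in> Q" for q using that by blast
  have pts: "Q \<subseteq> dual_pts" using Q(1) unfolding up_set_def by blast
  then have "subset.chain dual_pts Q"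
    using up_set_linear Q(1) unfolding subset_chain_def by blast
  then have "\<Inter>Q \<in> dual_pts" using dual_pts_Inter_chain[OF Q(2)] by blast
  moreover have "m \<subseteq> \<Inter>Q" using Q(1) unfolding up_set_def by blast
  moreover have "\<Inter>Q \<noteq> r" using Q(2) less le_r pts by blast
  ultimately obtain s where s: "imm_pred (\<Inter>Q) s"
    using no_down_limit[of "\<Inter>Q"] unfolding down_limit_def up_set_def by blast
  then have "s \<subseteq> \<Inter>Q" using imm_pred_above[OF s] less pts by blast
  then show False using imm_pred_less[OF s] by blast
qed

theorem up_set_well_order:
  "well_order_on (up_set m) {(x, y). x \<in> up_set m \<and> y \<in> up_set m \<and> x \<subseteq> y}"
    (is "well_order_on _ ?le")
proof -
  have "linear_order_on (up_set m) ?le"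
    using up_set_linear unfolding linear_order_on_def partial_order_on_def preorder_on_def
    by (auto simp: refl_on_def trans_def antisym_def total_on_def)
  moreover have "wf (?le - Id)"
  proof (rule wfI_min)
    fix x :: "'a set" and Q assume "x \<in> Q"
    show "\<exists>z\<in>Q. \<forall>y. (y, z) \<in> ?le - Id \<longrightarrow> y \<notin> Q"
    proof (cases "Q \<inter> up_set m = {}")
      case True
      then show ?thesis using \<open>x \<in> Q\<close> by blast
    next
      case False
      then have "\<Inter>(Q \<inter> up_set m) \<in> Q" using up_set_least by blast
      then show ?thesis by (intro bexI[of _ "\<Inter>(Q \<inter> up_set m)"]) blast+
    qed
  qed
  ultimately show ?thesis unfolding well_order_on_def by blast
qed

theorem up_set_infinite:
  assumes "infinite (UNIV :: 'a set)"
  shows "infinite (up_set m)"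
proof
  assume fin: "finite (up_set m)"
  have "y \<in> up_set m \<union> (\<Union>x\<in>spine. teeth x x)" if y: "y \<in> dual_pts" for y
  proof (cases "y \<in> up_set m")
    case False
    then have "y \<in> minimals" "y \<noteq> m" using spine_or_minimal[OF y] up_set_eq by blast+
    then obtain x where x: "imm_pred y x" "m \<subset> x" using hanging by blast
    then have "x \<in> spine" using imm_pred_pts(2)[OF x(1)] unfolding spine_def by simp
    then show ?thesis using mem_teeth_self_iff x(1) \<open>y \<in> minimals\<close> by blast
  qed simp
  moreover have "finite (up_set m \<union> (\<Union>x\<in>spine. teeth x x))"
    using fin finite_teeth(1) up_set_eq by simp
  ultimately have "finite (dual_pts :: 'a set set)" by (meson finite_subset subsetI)
  then show False using infinite_dual_pts[OF assms] by blast
qed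

theorem bottom_imm_preds:
  assumes mx: "imm_pred m x"
  shows "finite (imm_preds x)" "card (imm_preds x) \<le> 2"
proof -
  have m: "m \<in> up_set m" using up_set_eq by simp
  have unique: "y = y'" if "y \<in> imm_preds x - {m}" "y' \<in> imm_preds x - {m}" for y y'
  proof -
    have "\<not> m \<subseteq> z" if "z \<in> imm_preds x - {m}" for z
      using that imm_pred_no_between[OF mx] imm_predD(1,3)[of z x] unfolding imm_preds_def by blast
    then show ?thesis
      using successor_tooth_unique[OF no_F3 mx m] that unfolding imm_preds_def by simp
  qed
  obtain y where "imm_preds x - {m} \<subseteq> {y}"
    using unique by (cases "imm_preds x - {m} = {}") blast+
  then have "imm_preds x \<subseteq> {m, y}" by blast
  then show "finite (imm_preds x)" "card (imm_preds x) \<le> 2"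
    using finite_subset card_mono[of "{m, y}" "imm_preds x"] card_insert_le_m1[of 2 "{y}" m] by auto
qed

lemma non_limit_predecessor:
  assumes "x \<in> spine" "\<not> imm_pred m x" "\<not> up_limit m x"
  obtains z where "imm_pred z x" "z \<in> spine"
proof -
  obtain z where z: "z \<in> up_set m" "imm_pred z x"
    using assms(1,3) unfolding up_limit_def spine_def by auto
  then have "z \<in> spine" using assms(2) up_set_eq by auto
  then show thesis using that z(2) by blast
qed

lemma successor_imm_preds:
  assumes zx: "imm_pred z x" and z: "z \<in> spine"
  shows "\<exists>!z. imm_pred z x \<and> m \<subset> z" "\<exists>!t. imm_pred t x \<and> \<not> m \<subset> t"
proof -
  have z_up: "z \<in> up_set m" using z up_set_eq by blast
  note x = successor_in_spine[OF zx z_up]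
  show "\<exists>!z. imm_pred z x \<and> m \<subset> z"
  proof (rule ex1I)
    show "imm_pred z x \<and> m \<subset> z" using zx m_less_spine[OF z] by blast
    show "z' = z" if "imm_pred z' x \<and> m \<subset> z'" for z'
      using spine_linear[of z z'] z imm_predD[OF zx] imm_predD[of z' x] that
      unfolding spine_def by blast
  qed
  have below_not_m: "\<not> m \<subseteq> y" if "imm_pred y x" "\<not> m \<subset> y" for y
    using that imm_pred_no_between[OF that(1) spine_pt[OF z]] m_less_spine[OF z]
      imm_pred_less[OF zx] by blast
  show "\<exists>!t. imm_pred t x \<and> \<not> m \<subset> t"
  proof (rule ex_ex1I)
    obtain t where "t \<in> teeth x x" "\<not> t \<subseteq> z"
      using successor_tooth_exists[OF no_F1 no_F2 zx z] by blast
    then show "\<exists>t. imm_pred t x \<and> \<not> m \<subset> t"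
      using mem_teeth_self_iff[OF x] spine_not_minimal[of t] minimal_pt[of t]
      unfolding spine_def by blast
    show "t = t'" if "imm_pred t x \<and> \<not> m \<subset> t" "imm_pred t' x \<and> \<not> m \<subset> t'" for t t'
      using successor_tooth_unique[OF no_F3 zx z_up] below_not_m that by blast
  qed
qed

theorem non_limit_imm_preds:
  assumes "x \<in> dual_pts" "m \<subset> x" "\<not> imm_pred m x" "\<not> up_limit m x"
  shows "\<exists>!z. imm_pred z x \<and> m \<subset> z" "\<exists>!t. imm_pred t x \<and> \<not> m \<subset> t"
proof -
  have "x \<in> spine" using assms(1,2) unfolding spine_def by simp
  then obtain z where "imm_pred z x" "z \<in> spine"
    using non_limit_predecessor assms(3,4) by blast
  then show "\<exists>!z. imm_pred z x \<and> m \<subset> z" "\<exists>!t. imm_pred t x \<and> \<not> m \<subset> t"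
    by (rule successor_imm_preds)+
qed

lemma successor_below_up_limit:
  assumes limit: "up_limit m x" and c: "c \<in> spine_below x"
  obtains d where "imm_pred c d" "d \<in> spine_below x"
proof -
  have c_spine: "c \<in> spine" "c \<subset> x" using c unfolding spine_below_def by blast+
  note x = spine_pt[OF up_limitD(1)[OF limit]]
  have "c \<in> up_set m - {r}" using c_spine le_r[OF x] up_set_eq by blast
  then obtain d where d: "imm_pred c d"
    using no_down_limit unfolding down_limit_def by blast
  have "d \<noteq> x" using up_limitD(2)[OF limit] d c_spine(1) up_set_eq by blast
  then have "d \<subset> x" using imm_pred_above[OF d x c_spine(2)] by blast
  moreover have "d \<in> spine" using successor_in_spine[OF d] c_spine(1) up_set_eq by blast
  ultimately show thesis using that d unfolding spine_below_def by blast
qed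

lemma up_limit_teeth_not_singleton:
  assumes limit: "up_limit m x"
  shows "\<not> (\<forall>p\<in>teeth x x. \<forall>p'\<in>teeth x x. p = p')"
proof
  assume single: "\<forall>p\<in>teeth x x. \<forall>p'\<in>teeth x x. p = p'"
  obtain c where c: "c \<in> spine_below x" "colour c = colour x"
    and near: "colour ` {t \<in> minimals. t \<subseteq> x \<and> \<not> t \<subseteq> c} \<subseteq> colour ` teeth x x"
    using up_limit_neighbourhood[OF limit] .
  obtain a where a: "imm_pred c a" "a \<in> spine_below x"
    using successor_below_up_limit[OF limit c(1)] .
  have c_spine: "c \<in> spine" and ax: "a \<in> spine" "a \<subset> x"
    using c(1) a(2) unfolding spine_below_def by blast+
  note ca = imm_pred_less[OF a(1)]
  have recurs: "colour t \<in> colour ` teeth x x" if t: "t \<in> teeth a b" "b \<subseteq> x" for t b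
  proof -
    have "t \<in> {t \<in> minimals. t \<subseteq> x \<and> \<not> t \<subseteq> c}"
      using teethD(1,3)[OF t(1)] teethD(4)[OF t(1) c_spine] t(2) ca by blast
    then show ?thesis by (rule subsetD[OF near imageI])
  qed
  have "a = x"
  proof (rule segment_collapse(1)[OF ax(1) up_limitD(1)[OF limit]])
    show "a \<subseteq> x" "colour a = colour x" using c(2) ca ax(2) by blast+
    obtain t where t: "t \<in> teeth a a"
      using successor_tooth_exists[OF no_F1 no_F2 a(1) c_spine] by blast
    have "colour s = colour t" if s: "s \<in> teeth a x" for s
    proof -
      obtain p where "p \<in> teeth x x" "colour s = colour p"
        using recurs[OF s subset_refl] by (rule imageE)
      moreover obtain p' where "p' \<in> teeth x x" "colour t = colour p'"
        using recurs[OF t psubset_imp_subset[OF ax(2)]] by (rule imageE)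
      ultimately show ?thesis using single by metis
    qed
    then show "colour ` teeth a x \<subseteq> colour ` teeth a a" using t by blast
  qed
  then show False using ax(2) by blast
qed

theorem up_limit_imm_preds:
  assumes limit: "up_limit m x"
  shows "finite (imm_preds x)" "2 \<le> card (imm_preds x)" "card (imm_preds x) \<le> 2 ^ card G"
proof -
  note x = up_limitD(1)[OF limit]
  have "z \<in> minimals" if "imm_pred z x" for z
    using spine_or_minimal[OF imm_pred_pts(1)[OF that]] up_limitD(2)[OF limit, of z] that
      up_set_eq by blast
  then have eq: "imm_preds x = teeth x x"
    using mem_teeth_self_iff[OF x] unfolding imm_preds_def by blast
  show fin: "finite (imm_preds x)" and "card (imm_preds x) \<le> 2 ^ card G"
    using finite_teeth[OF x] unfolding eq by auto
  have "\<not> card (teeth x x) \<le> Suc 0"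
    using up_limit_teeth_not_singleton[OF limit] card_le_Suc0_iff_eq[OF finite_teeth(1)[OF x]]
    by simp
  then show "2 \<le> card (imm_preds x)" unfolding eq by simp
qed

end

theorem theorem3p19:
  fixes n :: nat
    and imp coimp :: "'a::{distrib_lattice,bounded_lattice} \<Rightarrow> 'a \<Rightarrow> 'a"
    and r m :: "'a set"
  assumes "0 < n"
    and "bi_heyting imp coimp"
    and "infinite (UNIV :: 'a set)"
    and "n_generated n imp coimp"
    and "bh_SI imp coimp"
    and "validates_LFC imp coimp"
    and "r \<in> dual_pts" and "\<forall>x\<in>dual_pts. x \<subseteq> r"
    and "m \<in> minimals"
    and "dual_pts = {x \<in> dual_pts. m \<subset> x} \<union> minimals"
    and "\<forall>y\<in>minimals. y \<noteq> m \<longrightarrow> (\<exists>!z. imm_pred y z \<and> m \<subset> z)"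
  shows "(\<forall>x. up_limit m x \<longrightarrow>
             finite (imm_preds x) \<and> 2 \<le> card (imm_preds x) \<and> card (imm_preds x) \<le> 2 ^ n)
       \<and> (\<forall>x. \<not> down_limit m r x)
       \<and> (infinite (up_set m) \<and>
          well_order_on (up_set m) {(x, y). x \<in> up_set m \<and> y \<in> up_set m \<and> x \<subseteq> y})
       \<and> (\<forall>x. imm_pred m x \<longrightarrow> finite (imm_preds x) \<and> card (imm_preds x) \<le> 2)
       \<and> (\<forall>x\<in>dual_pts. m \<subset> x \<and> \<not> imm_pred m x \<and> \<not> up_limit m x \<longrightarrow>
            (\<exists>!z. imm_pred z x \<and> m \<subset> z) \<and> (\<exists>!z. imm_pred z x \<and> \<not> m \<subset> z))"
proof -
  obtain G where G: "finite G" "card G \<le> n" "bh_generated imp coimp G = UNIV"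
    using assms(4) unfolding n_generated_def by blast
  interpret LFC_comb imp coimp m r G
  proof
    show "m \<subset> x \<or> x \<in> minimals" if "x \<in> dual_pts" for x
      using that assms(10) by blast
    show "\<exists>z. imm_pred t z \<and> m \<subset> z" if "t \<in> minimals" "t \<noteq> m" for t
      using that assms(11) by blast
  qed (use assms G in \<open>auto simp: validates_LFC_def\<close>)
  have card_le: "card (imm_preds x) \<le> 2 ^ n" if "up_limit m x" for x
    using order_trans[OF up_limit_imm_preds(3)[OF that] power_increasing[OF G(2)]] by simp
  show ?thesis
    by (intro conjI allI impI ballI; (elim conjE)?; rule up_limit_imm_preds card_le no_down_limit
        up_set_infinite[OF assms(3)] up_set_well_order bottom_imm_preds non_limit_imm_preds)
qed

end
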